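(* Let $D=(V(D),E(D),w)$ be a vertex-weighted rooted forest with at least one edge such that $w(x)\geq 2$ for every vertex $x\in V(D)$. Then $\operatorname{pd}(I(D))=|E(D)|-1$.
   Context: A vertex-weighted oriented graph is a triple $D=(V(D),E(D),w)$, where $V(D)=\{x_1,\dots,x_n\}$ is a finite vertex set, $E(D)$ is a set of ordered pairs of distinct vertices such that each pair of vertices is joined by at most one edge, in only one direction, and $w:V(D)\to\{1,2,\ldots\}$ is a weight function. An edge written $uv$ is directed from its starting point $u$ to its ending point $v$. A rooted tree is an oriented graph obtained by orienting the edges of an undirected tree so that all edges are oriented away from a fixed vertex, the root. A rooted forest is a disjoint union of rooted trees. Put $w_j=w(x_j)$. Let $k$ be a field and $S=k[x_1,\ldots,x_n]$ with the standard grading. The edge ideal of $D$ is the ideal $I(D)=(x_ix_j^{w_j}\mid x_ix_j\in E(D))\subset S$, where $x_ix_j\in E(D)$ is directed from $x_i$ to $x_j$. For a nonzero homogeneous ideal $I\subset S$ with graded Betti numbers $\beta_{i,j}(I)$ of $I$ as an $S$-module (so $\beta_{0,j}(I)$ is the number of minimal generators of degree $j$), $\operatorname{pd}(I)=\max\{i\mid\beta_{i,j}(I)\ne0\text{ for some }j\}$. *)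

theory Defs
  imports
    "HOL-Library.Poly_Mapping"
    "HOL-Library.Disjoint_Sets"
    "Graph_Theory.Digraph_Component"
    "Jordan_Normal_Form.Matrix_Kernel"
begin

section \<open>Vertex-weighted rooted forests\<close>

definition weighted_oriented_graph :: "'v pair_pre_digraph \<Rightarrow> ('v \<Rightarrow> nat) \<Rightarrow> bool" where
  "weighted_oriented_graph D w \<longleftrightarrow>
     pair_digraph D \<and> asym (parcs D) \<and> (\<forall>x\<in>pverts D. 1 \<le> w x)"

text \<open>
  \<^const>\<open>Digraph_Component.tree\<close> only excludes directed cycles. Here the underlying
  undirected graph has to be a tree; it is represented by the symmetric digraph
  \<^const>\<open>mk_symmetric\<close>, in which every edge is a directed cycle of length 2,
  so undirected cycles are the directed cycles of length at least 3.
\<close>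

definition underlying_tree :: "('a, 'b) pre_digraph \<Rightarrow> bool" where
  "underlying_tree T \<longleftrightarrow>
     Digraph_Component.connected T \<and>
     \<not> (\<exists>p. pre_digraph.cycle (mk_symmetric T) p \<and> 3 \<le> length p)"

text \<open>
  An edge \<open>uv\<close> is oriented away from \<open>r\<close> if the path from \<open>r\<close> to \<open>v\<close> in the underlying
  undirected tree ends with the step from \<open>u\<close> to \<open>v\<close>.
\<close>

definition rooted_tree :: "('a, 'b) pre_digraph \<Rightarrow> bool" where
  "rooted_tree T \<longleftrightarrow>
     underlying_tree T \<and>
     (\<exists>r\<in>verts T. \<forall>e\<in>arcs T. \<exists>p.
        pre_digraph.apath (mk_symmetric T) r (p @ [(tail T e, head T e)]) (head T e))"

definition rooted_forest :: "'v pair_pre_digraph \<Rightarrow> bool" where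
  "rooted_forest D \<longleftrightarrow>
     (\<exists>P. partition_on (pverts D) P \<and>
          parcs D \<subseteq> (\<Union>B\<in>P. B \<times> B) \<and>
          (\<forall>B\<in>P. rooted_tree (with_proj D \<restriction> B)))"

section \<open>Polynomials and ideals\<close>

text \<open>The polynomial ring over \<open>'k\<close> with one variable for each element of the finite type \<open>'v\<close>.\<close>

type_synonym ('v, 'k) mpoly = "('v \<Rightarrow>\<^sub>0 nat) \<Rightarrow>\<^sub>0 'k"

definition var :: "'v \<Rightarrow> ('v, 'k::comm_ring_1) mpoly" where
  "var v = Poly_Mapping.single (Poly_Mapping.single v 1) 1"

definition mon_degree :: "('v::finite \<Rightarrow>\<^sub>0 nat) \<Rightarrow> nat" where
  "mon_degree t = (\<Sum>v\<in>UNIV. Poly_Mapping.lookup t v)"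

text \<open>Ideals are the submodules of the ring, regarded as a module over itself.\<close>

lemma module_times: "Modules.module ((*) :: 'a::comm_ring_1 \<Rightarrow> 'a \<Rightarrow> 'a)"
  by unfold_locales (simp_all add: algebra_simps)

definition ideal_gen :: "'a::comm_ring_1 set \<Rightarrow> 'a set" where
  "ideal_gen B = Modules.module.span (*) B"

definition edge_ideal ::
  "'v pair_pre_digraph \<Rightarrow> ('v \<Rightarrow> nat) \<Rightarrow> ('v, 'k::field) mpoly set" where
  "edge_ideal D w = ideal_gen {var u * var v ^ w v | u v. (u, v) \<in> parcs D}"

section \<open>Graded Betti numbers\<close>

text \<open>
  The \<open>i\<close>-th module of the resolution is the direct sum of the \<open>S(- d i ! a)\<close> for
  \<open>a < length (d i)\<close>; its elements are column vectors. The matrix \<open>M (Suc i)\<close> is the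
  differential from the module in homological degree \<open>Suc i\<close> to the one in degree \<open>i\<close>, and
  the row \<open>M 0\<close> is the augmentation onto \<open>I\<close>. The two conditions on \<open>mon_degree\<close> say that
  these maps are homogeneous of degree 0. Shifts can be taken in \<^typ>\<open>nat\<close> because \<open>I\<close>
  and all its syzygies live in nonnegative degrees.
\<close>

definition graded_free_resolution ::
  "('v::finite, 'k::field) mpoly set \<Rightarrow> (nat \<Rightarrow> nat list) \<Rightarrow>
     (nat \<Rightarrow> ('v, 'k) mpoly mat) \<Rightarrow> bool" where
  "graded_free_resolution I d M \<longleftrightarrow>
     M 0 \<in> carrier_mat 1 (length (d 0)) \<and>
     (\<forall>i. M (Suc i) \<in> carrier_mat (length (d i)) (length (d (Suc i)))) \<and>
     (\<forall>b<length (d 0). \<forall>t\<in>Poly_Mapping.keys (M 0 $$ (0, b)). mon_degree t = d 0 ! b) \<and>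
     (\<forall>i. \<forall>a<length (d i). \<forall>b<length (d (Suc i)).
        \<forall>t\<in>Poly_Mapping.keys (M (Suc i) $$ (a, b)). mon_degree t + d i ! a = d (Suc i) ! b) \<and>
     (\<lambda>x. (M 0 *\<^sub>v x) $ 0) ` carrier_vec (length (d 0)) = I \<and>
     (\<forall>i. (\<lambda>x. M (Suc i) *\<^sub>v x) ` carrier_vec (length (d (Suc i))) = mat_kernel (M i))"

definition minimal_graded_free_resolution ::
  "('v::finite, 'k::field) mpoly set \<Rightarrow> (nat \<Rightarrow> nat list) \<Rightarrow>
     (nat \<Rightarrow> ('v, 'k) mpoly mat) \<Rightarrow> bool" where
  "minimal_graded_free_resolution I d M \<longleftrightarrow>
     graded_free_resolution I d M \<and>
     (\<forall>i. elements_mat (M (Suc i)) \<subseteq> ideal_gen (range var))"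

text \<open>
  Every homogeneous ideal has a minimal graded free resolution, unique up to isomorphism,
  so for such an ideal the description below determines the Betti number.
\<close>

definition graded_betti :: "('v::finite, 'k::field) mpoly set \<Rightarrow> nat \<Rightarrow> nat \<Rightarrow> nat" where
  "graded_betti I i j =
     (THE b. \<exists>d M. minimal_graded_free_resolution I d M \<and> b = count_list (d i) j)"

definition proj_dim :: "('v::finite, 'k::field) mpoly set \<Rightarrow> nat" where
  "proj_dim I = Max {i. \<exists>j. graded_betti I i j \<noteq> 0}"

end

theory Submission
  imports Defs
begin

text \<open>
  Each edge \<open>uv\<close> contributes the generator \<open>x_u x_v^(w v)\<close>. In a rooted forest a vertex has at
  most one parent, so every other generator contains \<open>x_v\<close> with exponent at most 1, whereas here
  the exponent is at least 2. Hence no generator divides the least common multiple of the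
  others.

  For monomials with this property the Taylor complex is a minimal resolution. Its basis in
  homological degree \<open>i\<close> consists of the sets of \<open>i + 1\<close> generators, and the entry of the
  differential from a set to a facet is, up to sign, the quotient of their least common
  multiples. The hypothesis says that this quotient is never 1
  (\<open>minimal_graded_free_resolution_taylor\<close>). With \<open>q\<close> generators the last nonzero module is the one
  in homological degree \<open>q - 1\<close>, spanned by the set of all generators, and \<open>q\<close> is the number of
  edges.

  The Taylor complex is exact for arbitrary monomials: in a fixed multidegree \<open>t\<close> it is the
  augmented chain complex of the simplex on the generators dividing \<open>t\<close>, and this is contracted
  by coning from one of those generators (\<open>taylor_diff_exact\<close>).

  Betti numbers are read off from any minimal resolution, so it remains to see that two of them
  have the same shifts (\<open>graded_betti_eq_count_list\<close>). Lifting the identity of the ideal gives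
  graded chain maps in both directions (\<open>comparison_chain_map\<close>). Their composites are homotopic
  to the identity, and homotopies vanish modulo the variables because the differentials do
  (\<open>const_coeff_chain_endomorphism\<close>). Taking constant coefficients therefore produces mutually
  inverse degree-preserving matrices over the field, whose numbers of rows and columns agree in
  each degree.
\<close>

section \<open>Homogeneous parts and constant coefficients\<close>

text \<open>
  Degrees are integers here although polynomials only have nonnegative ones: the entry in row
  \<open>a\<close> and column \<open>b\<close> of a graded matrix has degree \<open>c ! b - r ! a\<close>, and where this
  difference is negative the entry is forced to be zero without a case distinction.
\<close>

definition homogeneous :: "int \<Rightarrow> ('v::finite, 'k::field) mpoly \<Rightarrow> bool" where
  "homogeneous n p \<longleftrightarrow> (\<forall>t\<in>Poly_Mapping.keys p. int (mon_degree t) = n)"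

definition homogeneous_part :: "int \<Rightarrow> ('v::finite, 'k::field) mpoly \<Rightarrow> ('v, 'k) mpoly" where
  "homogeneous_part n p =
     Poly_Mapping.Abs_poly_mapping (\<lambda>t. Poly_Mapping.lookup p t when int (mon_degree t) = n)"

lemma lookup_homogeneous_part:
  "Poly_Mapping.lookup (homogeneous_part n p) t
     = (Poly_Mapping.lookup p t when int (mon_degree t) = n)"
proof -
  have "finite {t. (Poly_Mapping.lookup p t when int (mon_degree t) = n) \<noteq> 0}"
    by (rule finite_subset[OF _ finite_lookup[of p]]) auto
  then show ?thesis
    by (simp add: homogeneous_part_def)
qed

lemma homogeneous_homogeneous_part: "homogeneous n (homogeneous_part n p)"
  by (auto simp: homogeneous_def in_keys_iff lookup_homogeneous_part split: if_splits)

lemma homogeneous_part_ident: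
  assumes "homogeneous n p" shows "homogeneous_part n p = p"
proof (rule poly_mapping_eqI)
  fix t
  show "Poly_Mapping.lookup (homogeneous_part n p) t = Poly_Mapping.lookup p t"
    using assms by (cases "t \<in> Poly_Mapping.keys p")
      (auto simp: homogeneous_def lookup_homogeneous_part in_keys_iff)
qed

lemma homogeneous_part_sum:
  "homogeneous_part n (\<Sum>i\<in>I. f i) = (\<Sum>i\<in>I. homogeneous_part n (f i))"
  by (rule poly_mapping_eqI) (auto simp: lookup_homogeneous_part lookup_sum when_def)

lemma mon_degree_add: "mon_degree (s + t) = mon_degree s + mon_degree t"
  by (simp add: mon_degree_def lookup_add sum.distrib)

text \<open>
  Multiplication by a homogeneous polynomial commutes with taking homogeneous parts. This is
  what turns an arbitrary solution of a graded linear system into a graded one.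
\<close>

lemma homogeneous_part_mult:
  assumes "homogeneous e p"
  shows "homogeneous_part n (p * q) = p * homogeneous_part (n - e) q"
proof (rule poly_mapping_eqI)
  fix t
  have *: "Poly_Mapping.lookup p l *
        Sum_any (\<lambda>u. (Poly_Mapping.lookup q u when int (mon_degree u) = n - e) when t = l + u)
      = (Poly_Mapping.lookup p l * Sum_any (\<lambda>u. Poly_Mapping.lookup q u when t = l + u)
          when int (mon_degree t) = n)" for l
  proof (cases "l \<in> Poly_Mapping.keys p")
    case True
    then have deg: "int (mon_degree l) = e"
      using assms by (auto simp: homogeneous_def)
    have "Sum_any (\<lambda>u. (Poly_Mapping.lookup q u when int (mon_degree u) = n - e) when t = l + u)
        = Sum_any (\<lambda>u. (Poly_Mapping.lookup q u when t = l + u) when int (mon_degree t) = n)"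
      by (rule Sum_any.cong) (auto simp: when_def mon_degree_add deg[symmetric])
    then show ?thesis
      by (simp add: Sum_any_when_independent when_def)
  qed (simp add: in_keys_iff)
  show "Poly_Mapping.lookup (homogeneous_part n (p * q)) t =
        Poly_Mapping.lookup (p * homogeneous_part (n - e) q) t"
    unfolding lookup_homogeneous_part lookup_mult *
    by (simp add: Sum_any_when_independent)
qed

text \<open>
  The constant coefficient is the residue map from the polynomial ring to its quotient by the
  ideal of all variables; it is used in place of the tensor product with the residue field.
\<close>

definition const_coeff :: "('v::finite, 'k::field) mpoly \<Rightarrow> 'k" where
  "const_coeff p = Poly_Mapping.lookup p 0"

lemma add_eq_0_poly_mapping_nat:
  "s + t = 0 \<longleftrightarrow> s = 0 \<and> t = 0" for s t :: "'v \<Rightarrow>\<^sub>0 nat"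
  by (auto simp: poly_mapping_eq_iff fun_eq_iff lookup_add)

lemma const_coeff_mult:
  fixes p q :: "('v::finite, 'k::field) mpoly"
  shows "const_coeff (p * q) = const_coeff p * const_coeff q"
proof -
  have "const_coeff (p * q) =
      Sum_any (\<lambda>l. (Poly_Mapping.lookup p l * Poly_Mapping.lookup q 0) when l = 0)"
    unfolding const_coeff_def lookup_mult
  proof (rule Sum_any.cong)
    fix l
    have "Sum_any (\<lambda>u. Poly_Mapping.lookup q u when (0::'v \<Rightarrow>\<^sub>0 nat) = l + u)
        = Sum_any (\<lambda>u. (Poly_Mapping.lookup q u when u = 0) when l = 0)"
      by (rule Sum_any.cong)
        (auto simp: when_def add_eq_0_poly_mapping_nat eq_commute[of "0 :: 'v \<Rightarrow>\<^sub>0 nat"])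
    then show "Poly_Mapping.lookup p l * Sum_any (\<lambda>u. Poly_Mapping.lookup q u when 0 = l + u)
        = (Poly_Mapping.lookup p l * Poly_Mapping.lookup q 0 when l = 0)"
      by (simp add: Sum_any_when_independent when_def)
  qed
  then show ?thesis by (simp add: const_coeff_def)
qed

interpretation const_coeff: comm_ring_hom const_coeff
  by unfold_locales (simp_all add: const_coeff_mult, simp_all add: const_coeff_def lookup_add)

lemma map_mat_const_coeff_add:
  assumes "A \<in> carrier_mat n p" "B \<in> carrier_mat n p"
  shows "map_mat const_coeff (A + B) = map_mat const_coeff A + map_mat const_coeff B"
  using assms by (intro eq_matI) (auto simp: const_coeff.hom_add)

lemma const_coeff_ideal_gen_var:
  fixes p :: "('v::finite, 'k::field) mpoly"
  assumes "p \<in> ideal_gen (range var)" shows "const_coeff p = 0"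
proof -
  interpret M: Modules.module "(*) :: ('v::finite, 'k::field) mpoly \<Rightarrow> _ \<Rightarrow> _"
    by (rule module_times)
  have "Poly_Mapping.single v (1::nat) \<noteq> 0" for v :: 'v
    by (metis lookup_single_eq lookup_zero zero_neq_one)
  then have "const_coeff (var v :: ('v, 'k) mpoly) = 0" for v
    by (simp add: const_coeff_def var_def lookup_single when_def)
  note var = this
  have "p \<in> M.span (range var)"
    using assms by (simp add: ideal_gen_def)
  then show ?thesis using var
    by (induction rule: M.span_induct_alt) (auto simp: const_coeff.hom_add const_coeff_mult)
qed

section \<open>Matrices of graded maps\<close>

definition graded_mat ::
  "nat list \<Rightarrow> nat list \<Rightarrow> ('v::finite, 'k::field) mpoly mat \<Rightarrow> bool" where
  "graded_mat r c A \<longleftrightarrow> A \<in> carrier_mat (length r) (length c) \<and>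
     (\<forall>a<length r. \<forall>b<length c. homogeneous (int (c ! b) - int (r ! a)) (A $$ (a, b)))"

lemma index_mult_mat_sum:
  assumes "A \<in> carrier_mat n p" "B \<in> carrier_mat p q" "i < n" "j < q"
  shows "(A * B) $$ (i, j) = (\<Sum>k<p. A $$ (i, k) * B $$ (k, j))"
  using assms by (simp add: scalar_prod_def atLeast0LessThan)

lemma mat_mult_unit_vec:
  fixes A :: "'a::semiring_1 mat"
  assumes "A \<in> carrier_mat n p" "b < p"
  shows "A *\<^sub>v unit_vec p b = col A b"
  using col_mult2[OF assms(1) one_carrier_mat assms(2)] assms right_mult_one_mat[OF assms(1)]
  by (metis col_one)

lemma mat_lift:
  assumes A: "A \<in> carrier_mat n p" and B: "B \<in> carrier_mat n q"
    and im: "\<And>b. b < q \<Longrightarrow> col B b \<in> (\<lambda>x. A *\<^sub>v x) ` carrier_vec p"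
  obtains X where "X \<in> carrier_mat p q" "A * X = B"
proof -
  obtain x where x: "\<And>b. b < q \<Longrightarrow> x b \<in> carrier_vec p \<and> A *\<^sub>v x b = col B b"
    using im unfolding image_iff by metis
  define X where "X = mat p q (\<lambda>(a, b). x b $ a)"
  have "col (A * X) b = col B b" if "b < q" for b
  proof -
    have "col X b = x b"
      using x[OF that] that by (auto simp: X_def)
    moreover have "X \<in> carrier_mat p q"
      by (simp add: X_def)
    ultimately show ?thesis
      using x[OF that] by (simp add: col_mult2[OF A _ that])
  qed
  then have "A * X = B"
    using A B by (intro mat_col_eqI) (auto simp: X_def)
  then show ?thesis
    by (intro that[of X]) (auto simp: X_def)
qed

text \<open>
  If a graded system has any solution, replacing each entry by its part of the right degree
  gives a graded solution, since both sides of the equation are homogeneous in each entry.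
\<close>

lemma graded_mat_lift:
  assumes A: "graded_mat r s A" and B: "graded_mat r c B"
    and X: "X \<in> carrier_mat (length s) (length c)" "A * X = B"
  obtains Y where "graded_mat s c Y" "A * Y = B"
proof -
  define Y where "Y = mat (length s) (length c)
    (\<lambda>(a, b). homogeneous_part (int (c ! b) - int (s ! a)) (X $$ (a, b)))"
  have gY: "graded_mat s c Y"
    by (auto simp: graded_mat_def Y_def homogeneous_homogeneous_part)
  have "A * Y = B"
  proof (rule eq_matI)
    fix a b assume "a < dim_row B" "b < dim_col B"
    then have ab: "a < length r" "b < length c"
      using B by (auto simp: graded_mat_def)
    let ?n = "int (c ! b) - int (r ! a)"
    have "B $$ (a, b) = homogeneous_part ?n (B $$ (a, b))"
      using B ab by (simp add: graded_mat_def homogeneous_part_ident)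
    also have "\<dots> = homogeneous_part ?n (\<Sum>k<length s. A $$ (a, k) * X $$ (k, b))"
      using A X ab by (subst index_mult_mat_sum[symmetric]) (auto simp: graded_mat_def)
    also have "\<dots> = (\<Sum>k<length s. A $$ (a, k) * Y $$ (k, b))"
      unfolding homogeneous_part_sum
    proof (rule sum.cong)
      fix k assume "k \<in> {..<length s}"
      then have "homogeneous (int (s ! k) - int (r ! a)) (A $$ (a, k))" "k < length s"
        using A ab by (auto simp: graded_mat_def)
      then show "homogeneous_part ?n (A $$ (a, k) * X $$ (k, b)) = A $$ (a, k) * Y $$ (k, b)"
        using ab by (subst homogeneous_part_mult) (auto simp: Y_def)
    qed simp
    also have "\<dots> = (A * Y) $$ (a, b)"
      using A gY ab by (subst index_mult_mat_sum) (auto simp: graded_mat_def)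
    finally show "(A * Y) $$ (a, b) = B $$ (a, b)" ..
  qed (use A B gY in \<open>auto simp: graded_mat_def\<close>)
  with gY show ?thesis by (rule that)
qed

lemma graded_mat_mult:
  assumes A: "graded_mat r s A" and B: "graded_mat s c B"
  shows "graded_mat r c (A * B)"
proof -
  have cA: "A \<in> carrier_mat (length r) (length s)" and cB: "B \<in> carrier_mat (length s) (length c)"
    using A B by (auto simp: graded_mat_def)
  have "homogeneous (int (c ! b) - int (r ! a)) ((A * B) $$ (a, b))"
    if ab: "a < length r" "b < length c" for a b
  proof -
    let ?n = "int (c ! b) - int (r ! a)"
    have "homogeneous_part ?n ((A * B) $$ (a, b)) = (A * B) $$ (a, b)"
      unfolding index_mult_mat_sum[OF cA cB ab] homogeneous_part_sum
    proof (rule sum.cong)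
      fix k assume "k \<in> {..<length s}"
      then have "homogeneous (int (s ! k) - int (r ! a)) (A $$ (a, k))"
        "homogeneous (int (c ! b) - int (s ! k)) (B $$ (k, b))"
        using A B ab by (auto simp: graded_mat_def)
      then show "homogeneous_part ?n (A $$ (a, k) * B $$ (k, b)) = A $$ (a, k) * B $$ (k, b)"
        by (subst homogeneous_part_mult) (auto simp: homogeneous_part_ident)
    qed simp
    then show ?thesis
      by (metis homogeneous_homogeneous_part)
  qed
  then show ?thesis
    using A B by (auto simp: graded_mat_def)
qed

section \<open>Chain maps between resolutions\<close>

lemma graded_free_resolutionD:
  assumes "graded_free_resolution I d M"
  shows "graded_mat [0] (d 0) (M 0)"
    and "graded_mat (d i) (d (Suc i)) (M (Suc i))"
    and "(\<lambda>x. (M 0 *\<^sub>v x) $ 0) ` carrier_vec (length (d 0)) = I"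
    and "(\<lambda>x. M (Suc i) *\<^sub>v x) ` carrier_vec (length (d (Suc i))) = mat_kernel (M i)"
proof -
  show "graded_mat [0] (d 0) (M 0)"
    using assms by (auto simp: graded_free_resolution_def graded_mat_def homogeneous_def)
  have "int (mon_degree t) = int (d (Suc i) ! b) - int (d i ! a)"
    if "a < length (d i)" "b < length (d (Suc i))" "t \<in> Poly_Mapping.keys (M (Suc i) $$ (a, b))"
    for a b t
  proof -
    have "mon_degree t + d i ! a = d (Suc i) ! b"
      using assms that by (auto simp: graded_free_resolution_def)
    then show ?thesis by linarith
  qed
  then show "graded_mat (d i) (d (Suc i)) (M (Suc i))"
    using assms by (auto simp: graded_free_resolution_def graded_mat_def homogeneous_def)
qed (use assms in \<open>auto simp: graded_free_resolution_def\<close>)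

lemma graded_free_resolution_carrier:
  assumes "graded_free_resolution I d M"
  shows "M 0 \<in> carrier_mat 1 (length (d 0))"
    and "M (Suc i) \<in> carrier_mat (length (d i)) (length (d (Suc i)))"
  using assms by (auto simp: graded_free_resolution_def)

lemma graded_free_resolution_complex:
  assumes "graded_free_resolution I d M" and n: "M i \<in> carrier_mat n (length (d i))"
  shows "M i * M (Suc i) = 0\<^sub>m n (length (d (Suc i)))"
proof (rule mat_col_eqI)
  note c = graded_free_resolution_carrier(2)[OF assms(1), of i]
  fix b assume "b < dim_col (0\<^sub>m n (length (d (Suc i))) :: ('a, 'b) mpoly mat)"
  then have b: "b < length (d (Suc i))" by simp
  have "M (Suc i) *\<^sub>v unit_vec (length (d (Suc i))) b \<in> mat_kernel (M i)"
    unfolding graded_free_resolutionD(4)[OF assms(1), symmetric] by auto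
  then have "M i *\<^sub>v col (M (Suc i)) b = 0\<^sub>v n"
    using mat_kernelD[OF n] mat_mult_unit_vec[OF c b] by simp
  then show "col (M i * M (Suc i)) b = col (0\<^sub>m n (length (d (Suc i)))) b"
    using b c n by (simp add: col_mult2[OF n c b])
qed (use graded_free_resolution_carrier(2)[OF assms(1), of i] n in auto)

lemma graded_free_resolution_lift:
  assumes F: "graded_free_resolution I d M" and n: "M i \<in> carrier_mat n (length (d i))"
    and B: "B \<in> carrier_mat (length (d i)) q" "M i * B = 0\<^sub>m n q"
  obtains X where "X \<in> carrier_mat (length (d (Suc i))) q" "M (Suc i) * X = B"
proof (rule mat_lift[OF graded_free_resolution_carrier(2)[OF F] B(1)])
  fix b assume b: "b < q"
  have "M i *\<^sub>v col B b = col (M i * B) b"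
    using b n B(1) by (simp add: col_mult2[OF n B(1) b])
  then have "col B b \<in> mat_kernel (M i)"
    using b B by (intro mat_kernelI[OF n]) auto
  then show "col B b \<in> (\<lambda>x. M (Suc i) *\<^sub>v x) ` carrier_vec (length (d (Suc i)))"
    unfolding graded_free_resolutionD(4)[OF F] .
qed

text \<open>
  The comparison theorem for resolutions. At each stage the composite of the map built so far
  with the source differential lands in the kernel of a target differential, hence in the image
  of the next one, so it factors through the latter.
\<close>

lemma comparison_chain_map:
  assumes F: "graded_free_resolution I d M" and G: "graded_free_resolution I d' M'"
  obtains f where "\<And>i. graded_mat (d' i) (d i) (f i)" "M' 0 * f 0 = M 0"
    "\<And>i. M' (Suc i) * f (Suc i) = f i * M (Suc i)"
proof -
  note cF = graded_free_resolution_carrier[OF F] and cG = graded_free_resolution_carrier[OF G]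
  \<comment> \<open>The next step needs that composing with the source differential gives cycles of
    the target.\<close>
  define P where "P i g \<longleftrightarrow> graded_mat (d' i) (d i) g \<and>
     (\<exists>n. M' i \<in> carrier_mat n (length (d' i)) \<and>
          M' i * g * M (Suc i) = 0\<^sub>m n (length (d (Suc i)))) \<and> (i = 0 \<longrightarrow> M' 0 * g = M 0)"
    for i g
  have "\<exists>f. \<forall>i. P i (f i) \<and> M' (Suc i) * f (Suc i) = f i * M (Suc i)"
  proof (rule dependent_nat_choice)
    have "col (M 0) b \<in> (\<lambda>x. M' 0 *\<^sub>v x) ` carrier_vec (length (d' 0))"
      if b: "b < length (d 0)" for b
    proof -
      have "(M 0 *\<^sub>v unit_vec (length (d 0)) b) $ 0 \<in> (\<lambda>x. (M' 0 *\<^sub>v x) $ 0) ` carrier_vec (length (d' 0))"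
        unfolding graded_free_resolutionD(3)[OF G] graded_free_resolutionD(3)[OF F, symmetric]
        by (rule imageI) auto
      then obtain x where x: "x \<in> carrier_vec (length (d' 0))"
        and "col (M 0) b $ 0 = (M' 0 *\<^sub>v x) $ 0"
        using mat_mult_unit_vec[OF cF(1) b] by auto
      then have "col (M 0) b = M' 0 *\<^sub>v x"
        using cF(1) cG(1) by (intro eq_vecI) auto
      with x show ?thesis by blast
    qed
    then obtain X where "X \<in> carrier_mat (length (d' 0)) (length (d 0))" "M' 0 * X = M 0"
      using mat_lift[OF cG(1) cF(1)] by blast
    then obtain g where g: "graded_mat (d' 0) (d 0) g" "M' 0 * g = M 0"
      using graded_mat_lift graded_free_resolutionD(1)[OF F] graded_free_resolutionD(1)[OF G]
      by metis
    have "M' 0 * g * M (Suc 0) = 0\<^sub>m 1 (length (d (Suc 0)))"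
      unfolding g(2) by (rule graded_free_resolution_complex[OF F cF(1)])
    with g cG(1) show "\<exists>g. P 0 g"
      unfolding P_def by blast
  next
    fix g i assume "P i g"
    then obtain n where g: "graded_mat (d' i) (d i) g" and n: "M' i \<in> carrier_mat n (length (d' i))"
      and z: "M' i * g * M (Suc i) = 0\<^sub>m n (length (d (Suc i)))"
      unfolding P_def by blast
    have cg: "g \<in> carrier_mat (length (d' i)) (length (d i))"
      using g by (simp add: graded_mat_def)
    have "M' i * (g * M (Suc i)) = 0\<^sub>m n (length (d (Suc i)))"
      using z assoc_mult_mat[OF n cg cF(2)[of i]] by simp
    then obtain X where "X \<in> carrier_mat (length (d' (Suc i))) (length (d (Suc i)))"
      "M' (Suc i) * X = g * M (Suc i)"
      using graded_free_resolution_lift[OF G n mult_carrier_mat[OF cg cF(2)]] by metis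
    then obtain h where h: "graded_mat (d' (Suc i)) (d (Suc i)) h" "M' (Suc i) * h = g * M (Suc i)"
      using graded_mat_lift graded_free_resolutionD(2)[OF G]
        graded_mat_mult[OF g graded_free_resolutionD(2)[OF F]] by metis
    have "M' (Suc i) * h * M (Suc (Suc i)) = g * (M (Suc i) * M (Suc (Suc i)))"
      unfolding h(2) using cg cF(2) by (rule assoc_mult_mat) (rule cF(2))
    also have "\<dots> = 0\<^sub>m (length (d' i)) (length (d (Suc (Suc i))))"
      using cg by (subst graded_free_resolution_complex[OF F cF(2)]) simp
    finally have "P (Suc i) h"
      unfolding P_def using h(1) cG(2) by blast
    with h(2) show "\<exists>h. P (Suc i) h \<and> M' (Suc i) * h = g * M (Suc i)" by blast
  qed
  then show ?thesis
    unfolding P_def by (blast intro: that)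
qed

lemma mat_add_diff_cancel:
  fixes X :: "'a::comm_ring_1 mat"
  assumes "X \<in> carrier_mat n p" "Y \<in> carrier_mat n p" "Z \<in> carrier_mat n p"
  shows "X = Y + (Z + (X - Y - Z))"
  using assms by (intro eq_matI) auto

lemma mat_diff_diff_cancel:
  fixes X :: "'a::comm_ring_1 mat"
  assumes "X \<in> carrier_mat n p" "Y \<in> carrier_mat n p" "Z \<in> carrier_mat n p"
  shows "X - Y - (X - Y - Z) = Z"
  using assms by (intro eq_matI) auto

text \<open>
  A chain endomorphism over the identity of the ideal is homotopic to the identity. In a
  minimal resolution both terms of the homotopy \<open>h M + N k\<close> involve a differential, so they
  vanish modulo the variables and the endomorphism reduces to the identity there.
\<close>

lemma const_coeff_chain_endomorphism:
  fixes M :: "nat \<Rightarrow> ('v::finite, 'k::field) mpoly mat"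
  assumes F: "minimal_graded_free_resolution I d M"
    and c: "\<And>i. \<phi> i \<in> carrier_mat (length (d i)) (length (d i))"
    and \<phi>_0: "M 0 * \<phi> 0 = M 0"
    and \<phi>_Suc: "\<And>i. M (Suc i) * \<phi> (Suc i) = \<phi> i * M (Suc i)"
  shows "map_mat const_coeff (\<phi> i) = 1\<^sub>m (length (d i))"
proof -
  let ?c = "map_mat const_coeff :: ('v, 'k) mpoly mat \<Rightarrow> 'k mat"
  have F': "graded_free_resolution I d M"
    using F by (simp add: minimal_graded_free_resolution_def)
  note cF = graded_free_resolution_carrier[OF F']
  have M0: "?c (M (Suc i)) = 0\<^sub>m (length (d i)) (length (d (Suc i)))" for i
  proof (rule eq_matI)
    fix a b assume "a < dim_row (0\<^sub>m (length (d i)) (length (d (Suc i))) :: 'k mat)"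
      "b < dim_col (0\<^sub>m (length (d i)) (length (d (Suc i))) :: 'k mat)"
    then have ab: "a < length (d i)" "b < length (d (Suc i))" by auto
    have "M (Suc i) $$ (a, b) \<in> elements_mat (M (Suc i))"
      by (rule elements_matI[OF cF(2) ab refl])
    then have "const_coeff (M (Suc i) $$ (a, b)) = 0"
      using F const_coeff_ideal_gen_var by (auto simp: minimal_graded_free_resolution_def)
    then show "?c (M (Suc i)) $$ (a, b) = 0\<^sub>m (length (d i)) (length (d (Suc i))) $$ (a, b)"
      using ab cF(2)[of i] by auto
  qed (use cF(2)[of i] in auto)
  have "\<exists>h \<in> carrier_mat (length (d (Suc i))) (length (d i)).
      (\<phi> i - 1\<^sub>m (length (d i)) - M (Suc i) * h) * M (Suc i)
        = 0\<^sub>m (length (d i)) (length (d (Suc i))) \<and>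
      ?c (\<phi> i) = 1\<^sub>m (length (d i))"
  proof (induction i)
    case 0
    let ?n = "length (d 0)"
    have "M 0 * (\<phi> 0 - 1\<^sub>m ?n) = 0\<^sub>m 1 ?n"
      using cF(1) c[of 0] \<phi>_0
      by (simp add: mult_minus_distrib_mat[OF cF(1) c[of 0] one_carrier_mat])
    with c[of 0] obtain h where h: "h \<in> carrier_mat (length (d (Suc 0))) ?n"
      and eq: "M (Suc 0) * h = \<phi> 0 - 1\<^sub>m ?n"
      using graded_free_resolution_lift[OF F' cF(1)] c[of 0] by (metis minus_carrier_mat one_carrier_mat)
    have "\<phi> 0 = 1\<^sub>m ?n + M (Suc 0) * h"
      unfolding eq using c[of 0] by (intro eq_matI) auto
    then have "?c (\<phi> 0) = ?c (1\<^sub>m ?n) + ?c (M (Suc 0)) * ?c h"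
      using h cF(2)[of 0] 
      by (simp add: map_mat_const_coeff_add[of _ ?n ?n] const_coeff.mat_hom_mult[OF cF(2) h])
    also have "\<dots> = 1\<^sub>m ?n"
      using h by (simp add: M0 const_coeff.mat_hom_one)
    finally have "?c (\<phi> 0) = 1\<^sub>m ?n" .
    moreover have "(\<phi> 0 - 1\<^sub>m ?n - M (Suc 0) * h) * M (Suc 0) = 0\<^sub>m ?n (length (d (Suc 0)))"
      unfolding eq using c[of 0] cF(2)[of 0] by (subst minus_r_inv_mat[of _ ?n ?n]) auto
    ultimately show ?case using h by blast
  next
    case (Suc i)
    let ?n = "length (d i)" and ?m = "length (d (Suc i))" and ?M = "M (Suc i)" and ?N = "M (Suc (Suc i))"
    obtain h where h: "h \<in> carrier_mat ?m ?n"
      and z: "(\<phi> i - 1\<^sub>m ?n - ?M * h) * ?M = 0\<^sub>m ?n ?m"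
      using Suc by blast
    note cM = cF(2)[of i] and cN = cF(2)[of "Suc i"]
    have cMh: "?M * h \<in> carrier_mat ?n ?n" and chM: "h * ?M \<in> carrier_mat ?m ?m"
      using h cM by auto
    \<comment> \<open>What remains after subtracting the previous homotopy is killed by the differential,
      so exactness provides the next homotopy \<open>k\<close>.\<close>
    define B where "B = \<phi> (Suc i) - 1\<^sub>m ?m - h * ?M"
    have cB: "B \<in> carrier_mat ?m ?m"
      unfolding B_def by (rule minus_carrier_mat[OF chM])
    have "?M * B = ?M * \<phi> (Suc i) - ?M - ?M * (h * ?M)"
      unfolding B_def mult_minus_distrib_mat[OF cM minus_carrier_mat[OF one_carrier_mat] chM]
        mult_minus_distrib_mat[OF cM c one_carrier_mat] right_mult_one_mat[OF cM] ..
    also have "\<dots> = \<phi> i * ?M - ?M - ?M * h * ?M"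
      using \<phi>_Suc[of i] assoc_mult_mat[OF cM h cM] by simp
    also have "\<dots> = (\<phi> i - 1\<^sub>m ?n - ?M * h) * ?M"
      unfolding minus_mult_distrib_mat[OF minus_carrier_mat[OF one_carrier_mat] cMh cM]
        minus_mult_distrib_mat[OF c one_carrier_mat cM] left_mult_one_mat[OF cM] ..
    also note z
    finally obtain k where k: "k \<in> carrier_mat (length (d (Suc (Suc i)))) ?m" and eq: "?N * k = B"
      using graded_free_resolution_lift[OF F' cM cB] by blast
    have cNk: "?N * k \<in> carrier_mat ?m ?m"
      using cN k by auto
    have split: "\<phi> (Suc i) = 1\<^sub>m ?m + (h * ?M + ?N * k)"
      unfolding eq B_def by (rule mat_add_diff_cancel[OF c one_carrier_mat chM])
    have "?c (\<phi> (Suc i)) = ?c (1\<^sub>m ?m) + (?c h * ?c ?M + ?c ?N * ?c k)"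
      unfolding split using h cM cN k chM cNk
      by (simp add: map_mat_const_coeff_add[of _ ?m ?m] const_coeff.mat_hom_mult[OF cN k]
          const_coeff.mat_hom_mult[OF h cM])
    also have "\<dots> = 1\<^sub>m ?m"
      using h k by (simp add: M0 const_coeff.mat_hom_one)
    finally have c1: "?c (\<phi> (Suc i)) = 1\<^sub>m ?m" .
    have "\<phi> (Suc i) - 1\<^sub>m ?m - ?N * k = h * ?M"
      unfolding eq B_def by (rule mat_diff_diff_cancel[OF c one_carrier_mat chM])
    then have "(\<phi> (Suc i) - 1\<^sub>m ?m - ?N * k) * ?N = h * (?M * ?N)"
      using assoc_mult_mat[OF h cM cN] by simp
    also have "\<dots> = 0\<^sub>m ?m (length (d (Suc (Suc i))))"
      using h by (subst graded_free_resolution_complex[OF F' cM]) simp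
    finally show ?case
      using k c1 by blast
  qed
  then show ?thesis by blast
qed

section \<open>Uniqueness of the Betti numbers\<close>

text \<open>
  If \<open>p\<close> were larger than \<open>q\<close>, padding with zeros would give square matrices with product 1,
  the first of which has a zero column.
\<close>

lemma right_inverse_dim_le:
  fixes A B :: "'a::field mat"
  assumes A: "A \<in> carrier_mat p q" and B: "B \<in> carrier_mat q p" and AB: "A * B = 1\<^sub>m p"
  shows "p \<le> q"
proof (rule ccontr)
  assume "\<not> p \<le> q"
  then have qp: "q < p" by simp
  define A' where "A' = mat p p (\<lambda>(i, j). if j < q then A $$ (i, j) else 0)"
  define B' where "B' = mat p p (\<lambda>(i, j). if i < q then B $$ (i, j) else 0)"
  have car: "A' \<in> carrier_mat p p" "B' \<in> carrier_mat p p"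
    by (auto simp: A'_def B'_def)
  have "A' * B' = 1\<^sub>m p"
    unfolding AB[symmetric]
  proof (rule eq_matI)
    fix i j assume "i < dim_row (A * B)" "j < dim_col (A * B)"
    then have ij: "i < p" "j < p" using A B by auto
    have "(A' * B') $$ (i, j) = (\<Sum>k<p. A' $$ (i, k) * B' $$ (k, j))"
      by (rule index_mult_mat_sum[OF car ij])
    also have "\<dots> = (\<Sum>k<q. A $$ (i, k) * B $$ (k, j))"
      using qp ij by (intro sum.mono_neutral_cong_right) (auto simp: A'_def B'_def)
    also have "\<dots> = (A * B) $$ (i, j)"
      by (rule index_mult_mat_sum[OF A B ij, symmetric])
    finally show "(A' * B') $$ (i, j) = (A * B) $$ (i, j)" .
  qed (use A B car in auto)
  then have "det A' * det B' = 1"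
    by (metis car det_mult det_one)
  moreover have "det A' = 0"
  proof -
    have "A' *\<^sub>v unit_vec p q = 0\<^sub>v p"
      unfolding mat_mult_unit_vec[OF car(1) qp] using qp by (intro eq_vecI) (auto simp: A'_def)
    then show ?thesis
      unfolding det_0_iff_vec_prod_zero_field[OF car(1)]
      using qp by (intro exI[of _ "unit_vec p q"]) auto
  qed
  ultimately show False by simp
qed

text \<open>
  Degree-preserving matrices are block diagonal by degree, so the rank argument applies to the
  block of each degree \<open>j\<close> separately.
\<close>

lemma count_list_le_if_graded_right_inverse:
  fixes A B :: "'a::field mat"
  assumes A: "A \<in> carrier_mat (length r) (length s)" and B: "B \<in> carrier_mat (length s) (length r)"
    and AB: "A * B = 1\<^sub>m (length r)"
    and deg: "\<And>a b. a < length r \<Longrightarrow> b < length s \<Longrightarrow> A $$ (a, b) \<noteq> 0 \<Longrightarrow> r ! a = s ! b"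
  shows "count_list r j \<le> count_list s j"
proof -
  \<comment> \<open>\<open>u\<close> and \<open>v\<close> list the positions of degree \<open>j\<close>; the submatrices on them are the blocks.\<close>
  define u where "u = filter (\<lambda>a. r ! a = j) [0..<length r]"
  define v where "v = filter (\<lambda>a. s ! a = j) [0..<length s]"
  have len: "length (filter (\<lambda>a. l ! a = j) [0..<length l]) = count_list l j" for l :: "'b list"
    by (simp add: count_list_eq_length_filter length_filter_conv_card)
      (rule arg_cong[where f = card], auto)
  have u: "u ! i < length r" "r ! (u ! i) = j" if "i < length u" for i
    using nth_mem[OF that] by (auto simp: u_def)
  have v: "v ! i < length s" "s ! (v ! i) = j" if "i < length v" for i
    using nth_mem[OF that] by (auto simp: v_def)
  have du: "distinct u" and dv: "distinct v" by (auto simp: u_def v_def)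
  define A' where "A' = mat (length u) (length v) (\<lambda>(i, k). A $$ (u ! i, v ! k))"
  define B' where "B' = mat (length v) (length u) (\<lambda>(k, i). B $$ (v ! k, u ! i))"
  have car: "A' \<in> carrier_mat (length u) (length v)" "B' \<in> carrier_mat (length v) (length u)"
    by (auto simp: A'_def B'_def)
  have "A' * B' = 1\<^sub>m (length u)"
  proof (rule eq_matI)
    fix i k assume "i < dim_row (1\<^sub>m (length u) :: 'a mat)" "k < dim_col (1\<^sub>m (length u) :: 'a mat)"
    then have ik: "i < length u" "k < length u" by auto
    have "(A' * B') $$ (i, k) = (\<Sum>l<length v. A $$ (u ! i, v ! l) * B $$ (v ! l, u ! k))"
      unfolding index_mult_mat_sum[OF car ik] using ik
      by (intro sum.cong) (auto simp: A'_def B'_def)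
    also have "\<dots> = (\<Sum>l\<in>set v. A $$ (u ! i, l) * B $$ (l, u ! k))"
      using sum.reindex_bij_betw[OF bij_betw_nth[OF dv refl refl],
          of "\<lambda>l. A $$ (u ! i, l) * B $$ (l, u ! k)"] .
    also have "\<dots> = (\<Sum>l<length s. A $$ (u ! i, l) * B $$ (l, u ! k))"
      using u[OF ik(1)] deg[of "u ! i"]
      by (intro sum.mono_neutral_left) (auto simp: v_def)
    also have "\<dots> = (1\<^sub>m (length r) :: 'a mat) $$ (u ! i, u ! k)"
      unfolding AB[symmetric] using u ik by (intro index_mult_mat_sum[OF A B, symmetric]) auto
    also have "\<dots> = 1\<^sub>m (length u) $$ (i, k)"
      using u ik du by (simp add: nth_eq_iff_index_eq)
    finally show "(A' * B') $$ (i, k) = 1\<^sub>m (length u) $$ (i, k)" .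
  qed (use car in auto)
  from right_inverse_dim_le[OF car this] show ?thesis
    by (simp add: u_def v_def len)
qed

lemma const_coeff_graded_mat:
  assumes "graded_mat r c A" "a < length r" "b < length c" "map_mat const_coeff A $$ (a, b) \<noteq> 0"
  shows "r ! a = c ! b"
proof -
  have "0 \<in> Poly_Mapping.keys (A $$ (a, b))"
    using assms by (auto simp: graded_mat_def const_coeff_def in_keys_iff)
  then have "int (mon_degree (0 :: 'a \<Rightarrow>\<^sub>0 nat)) = int (c ! b) - int (r ! a)"
    using assms by (auto simp: graded_mat_def homogeneous_def)
  then show ?thesis by (simp add: mon_degree_def)
qed

text \<open>
  Chain maps in both directions compose to an endomorphism of the first resolution. Modulo the
  variables the composite is the identity, so the graded free modules of the first resolution
  are no larger than those of the second; symmetry then gives equality.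
\<close>

lemma count_list_shifts_le:
  assumes F: "minimal_graded_free_resolution I d M" and G: "minimal_graded_free_resolution I d' M'"
  shows "count_list (d i) j \<le> count_list (d' i) j"
proof -
  have F': "graded_free_resolution I d M" and G': "graded_free_resolution I d' M'"
    using F G by (auto simp: minimal_graded_free_resolution_def)
  note cF = graded_free_resolution_carrier[OF F'] and cG = graded_free_resolution_carrier[OF G']
  obtain f where f: "\<And>i. graded_mat (d' i) (d i) (f i)" "M' 0 * f 0 = M 0"
    "\<And>i. M' (Suc i) * f (Suc i) = f i * M (Suc i)"
    using comparison_chain_map[OF F' G'] by blast
  obtain g where g: "\<And>i. graded_mat (d i) (d' i) (g i)" "M 0 * g 0 = M' 0"
    "\<And>i. M (Suc i) * g (Suc i) = g i * M' (Suc i)"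
    using comparison_chain_map[OF G' F'] by blast
  have cf: "f i \<in> carrier_mat (length (d' i)) (length (d i))"
    and cg: "g i \<in> carrier_mat (length (d i)) (length (d' i))" for i
    using f(1) g(1) by (auto simp: graded_mat_def)
  have "map_mat const_coeff (g i * f i) = 1\<^sub>m (length (d i))"
  proof (rule const_coeff_chain_endomorphism[OF F])
    show "g i * f i \<in> carrier_mat (length (d i)) (length (d i))" for i
      by (rule mult_carrier_mat[OF cg cf])
    show "M 0 * (g 0 * f 0) = M 0"
      using assoc_mult_mat[OF cF(1) cg cf] f(2) g(2) by simp
    show "M (Suc i) * (g (Suc i) * f (Suc i)) = g i * f i * M (Suc i)" for i
    proof -
      have "M (Suc i) * (g (Suc i) * f (Suc i)) = g i * M' (Suc i) * f (Suc i)"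
        using assoc_mult_mat[OF cF(2) cg cf, of i] g(3) by simp
      also have "\<dots> = g i * (f i * M (Suc i))"
        using assoc_mult_mat[OF cg cG(2) cf, of i] f(3) by simp
      also have "\<dots> = g i * f i * M (Suc i)"
        using assoc_mult_mat[OF cg cf cF(2), of i] by simp
      finally show ?thesis .
    qed
  qed
  then have "map_mat const_coeff (g i) * map_mat const_coeff (f i) = 1\<^sub>m (length (d i))"
    by (simp add: const_coeff.mat_hom_mult[OF cg cf])
  then show ?thesis
    using const_coeff_graded_mat[OF g(1)] cf cg
    by (intro count_list_le_if_graded_right_inverse) auto
qed

theorem graded_betti_eq_count_list:
  assumes "minimal_graded_free_resolution I d M"
  shows "graded_betti I i j = count_list (d i) j"
  unfolding graded_betti_def
  by (rule the_equality) (use assms count_list_shifts_le in \<open>blast intro: order.antisym\<close>)+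

section \<open>Divisibility and least common multiples of monomials\<close>

definition mono_dvd :: "('v \<Rightarrow>\<^sub>0 nat) \<Rightarrow> ('v \<Rightarrow>\<^sub>0 nat) \<Rightarrow> bool" where
  "mono_dvd s t \<longleftrightarrow> (\<forall>v. Poly_Mapping.lookup s v \<le> Poly_Mapping.lookup t v)"

lemma mono_dvd_iff_add: "mono_dvd s t \<longleftrightarrow> (\<exists>u. t = s + u)"
proof
  assume "mono_dvd s t"
  then have "t = s + (t - s)"
    by (intro poly_mapping_eqI) (simp add: mono_dvd_def lookup_add lookup_minus)
  then show "\<exists>u. t = s + u" ..
qed (auto simp: mono_dvd_def lookup_add)

lemma lookup_single_mult:
  "Poly_Mapping.lookup (Poly_Mapping.single s c * p) t
     = (if mono_dvd s t then c * Poly_Mapping.lookup p (t - s) else 0)"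
  for s t :: "'v \<Rightarrow>\<^sub>0 nat" and p :: "('v, 'k::comm_ring_1) mpoly"
proof -
  have "Poly_Mapping.lookup (Poly_Mapping.single s c * p) t =
      Sum_any (\<lambda>l. c * Sum_any (\<lambda>u. Poly_Mapping.lookup p u when t = s + u) when l = s)"
    unfolding lookup_mult by (rule Sum_any.cong) (auto simp: lookup_single when_def)
  also have "\<dots> = c * Sum_any (\<lambda>u. Poly_Mapping.lookup p u when t = s + u)"
    by simp
  also have "\<dots> = (if mono_dvd s t then c * Poly_Mapping.lookup p (t - s) else 0)"
  proof (cases "mono_dvd s t")
    case True
    then obtain u where u: "t = s + u" by (auto simp: mono_dvd_iff_add)
    then show ?thesis by (simp add: mono_dvd_iff_add)
  next
    case False
    then have "t \<noteq> s + u" for u by (auto simp: mono_dvd_iff_add)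
    with False show ?thesis by simp
  qed
  finally show ?thesis .
qed

definition mono_lcm :: "(nat \<Rightarrow> 'v::finite \<Rightarrow>\<^sub>0 nat) \<Rightarrow> nat set \<Rightarrow> 'v \<Rightarrow>\<^sub>0 nat" where
  "mono_lcm m A = Poly_Mapping.Abs_poly_mapping
     (\<lambda>v. Max (insert 0 ((\<lambda>e. Poly_Mapping.lookup (m e) v) ` A)))"

lemma lookup_mono_lcm:
  "Poly_Mapping.lookup (mono_lcm m A) v = Max (insert 0 ((\<lambda>e. Poly_Mapping.lookup (m e) v) ` A))"
  by (simp add: mono_lcm_def)

lemma mono_lcm_dvd_iff:
  "finite A \<Longrightarrow> mono_dvd (mono_lcm m A) t \<longleftrightarrow> (\<forall>e\<in>A. mono_dvd (m e) t)"
  by (auto simp: mono_dvd_def lookup_mono_lcm)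

lemma mono_lcm_mono: "finite B \<Longrightarrow> A \<subseteq> B \<Longrightarrow> mono_dvd (mono_lcm m A) (mono_lcm m B)"
  by (auto simp: mono_dvd_def lookup_mono_lcm intro!: Max_mono)

lemma mono_lcm_empty: "mono_lcm m {} = 0"
  by (rule poly_mapping_eqI) (simp add: lookup_mono_lcm)

lemma mono_lcm_singleton: "mono_lcm m {e} = m e"
  by (rule poly_mapping_eqI) (simp add: lookup_mono_lcm)

section \<open>The simplex and its cone contraction\<close>

text \<open>
  The sign of the vertex \<open>e\<close> in a face is determined by the number of smaller vertices, so it
  is the same whether or not \<open>e\<close> itself is counted among them.
\<close>

definition face_sign :: "nat \<Rightarrow> nat set \<Rightarrow> 'k::comm_ring_1" where
  "face_sign e A = (- 1) ^ card (A \<inter> {..<e})"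

lemma face_sign_square: "face_sign e A * face_sign e A = 1"
  by (simp add: face_sign_def flip: power_mult_distrib)

lemma face_sign_insert_self: "face_sign e (insert e A) = face_sign e A"
  by (simp add: face_sign_def)

lemma face_sign_insert:
  assumes "finite A" "f \<notin> A" "f \<noteq> e"
  shows "face_sign e (insert f A) = (if f < e then - face_sign e A else face_sign e A)"
  using assms by (auto simp: face_sign_def Int_insert_left)

lemma face_sign_swap:
  assumes "finite A" "e \<notin> A" "f \<notin> A" "e \<noteq> f"
  shows "face_sign e A * face_sign f (insert e A) = - (face_sign f A * face_sign e (insert f A))"
  using assms by (cases "e < f") (auto simp: face_sign_insert)

text \<open>
  A chain is given by its coefficients, so the boundary at \<open>A\<close> collects the faces that
  contain \<open>A\<close> as a facet. The empty face is included: this is the augmented chain complex of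
  the full simplex on \<open>q\<close> vertices.
\<close>

definition boundary :: "nat \<Rightarrow> (nat set \<Rightarrow> 'k) \<Rightarrow> nat set \<Rightarrow> 'k::comm_ring_1" where
  "boundary q c A = (\<Sum>e\<in>{..<q} - A. face_sign e A * c (insert e A))"

lemma sum_antisym_eq_0:
  fixes g :: "'a \<Rightarrow> 'a \<Rightarrow> 'k::comm_ring_1"
  assumes "finite U" "\<And>e f. e \<in> U \<Longrightarrow> f \<in> U \<Longrightarrow> e \<noteq> f \<Longrightarrow> g e f = - g f e"
  shows "(\<Sum>e\<in>U. \<Sum>f\<in>U - {e}. g e f) = 0"
  using assms
proof (induction U)
  case (insert x U)
  have "(\<Sum>f\<in>insert x U - {e}. g e f) = g e x + (\<Sum>f\<in>U - {e}. g e f)" if "e \<in> U" for e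
  proof -
    have "insert x U - {e} = insert x (U - {e})" using insert.hyps that by auto
    then show ?thesis using insert.hyps by simp
  qed
  moreover have "insert x U - {x} = U" using insert.hyps by auto
  moreover have "(\<Sum>e\<in>U. g e x) = - (\<Sum>f\<in>U. g x f)"
    unfolding sum_negf[symmetric]
  proof (rule sum.cong)
    fix e assume "e \<in> U"
    then show "g e x = - g x e" using insert.hyps insert.prems[of e x] by auto
  qed simp
  moreover have "(\<Sum>e\<in>U. \<Sum>f\<in>U - {e}. g e f) = 0"
    by (rule insert.IH) (rule insert.prems, auto)
  ultimately show ?case
    using insert.hyps by (simp add: sum.distrib)
qed simp

lemma boundary_boundary:
  assumes A: "A \<subseteq> {..<q}"
  shows "boundary q (boundary q c) A = 0"
proof -
  from A have fin: "finite A" by (rule finite_subset) simp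
  let ?U = "{..<q} - A"
  define g where "g e f = face_sign e A * (face_sign f (insert e A) * c (insert f (insert e A)))" for e f
  have "boundary q (boundary q c) A = (\<Sum>e\<in>?U. \<Sum>f\<in>?U - {e}. g e f)"
    unfolding boundary_def g_def sum_distrib_left
    by (intro sum.cong) auto
  also have "\<dots> = 0"
  proof (rule sum_antisym_eq_0)
    fix e f assume "e \<in> ?U" "f \<in> ?U" "e \<noteq> f"
    then show "g e f = - g f e"
      using face_sign_swap[OF fin, of e f, where 'a = 'a]
      by (simp add: g_def insert_commute flip: mult.assoc)
  qed simp
  finally show ?thesis .
qed

text \<open>
  The cone from the vertex \<open>j\<close>, the classical contraction of a simplex.
\<close>

definition cone :: "nat \<Rightarrow> (nat set \<Rightarrow> 'k) \<Rightarrow> nat set \<Rightarrow> 'k::comm_ring_1" where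
  "cone j c B = (if j \<in> B then face_sign j B * c (B - {j}) else 0)"

text \<open>
  The contraction identity \<open>\<partial>h + h\<partial> = 1\<close>, evaluated at a face \<open>A\<close> where the term \<open>h\<partial>\<close>
  vanishes. If \<open>j\<close> is not in \<open>A\<close>, just the summand of \<open>j\<close> survives. If it is, the sum over the other vertices is, up to the sign of
  \<open>j\<close>, the part of the boundary at \<open>A - {j}\<close> that does not come from \<open>A\<close>, and that boundary
  vanishes.
\<close>

lemma boundary_cone:
  fixes c :: "nat set \<Rightarrow> 'k::comm_ring_1"
  assumes j: "j < q" and A: "A \<subseteq> {..<q}" and cycle: "j \<in> A \<Longrightarrow> boundary q c (A - {j}) = 0"
  shows "boundary q (cone j c) A = c A"
proof (cases "j \<in> A")
  case False
  have "boundary q (cone j c) A = (\<Sum>e\<in>{j}. face_sign e A * cone j c (insert e A))"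
    unfolding boundary_def using j False by (intro sum.mono_neutral_right) (auto simp: cone_def)
  also have "\<dots> = c A"
    using False by (simp add: cone_def face_sign_insert_self face_sign_square flip: mult.assoc)
  finally show ?thesis .
next
  case True
  define A' where "A' = A - {j}"
  have A': "A = insert j A'" "j \<notin> A'" "finite A'"
    using True A finite_subset[OF A] by (auto simp: A'_def)
  let ?s = "\<Sum>e\<in>{..<q} - A. face_sign e A' * c (insert e A')"
  have "{..<q} - A' = insert j ({..<q} - A)"
    using A' j by auto
  then have "boundary q c A' = (\<Sum>e\<in>insert j ({..<q} - A). face_sign e A' * c (insert e A'))"
    by (simp only: boundary_def)
  also have "\<dots> = face_sign j A' * c A + ?s"
    unfolding A'(1)[symmetric] using True by (subst sum.insert) (simp_all add: A'(1)[symmetric])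
  also have "boundary q c A' = 0"
    using cycle[OF True] by (simp only: A'_def)
  finally have s: "?s = - (face_sign j A' * c A)"
    by (simp add: eq_neg_iff_add_eq_0 add.commute)
  have "boundary q (cone j c) A = (\<Sum>e\<in>{..<q} - A. - face_sign j A' * (face_sign e A' * c (insert e A')))"
    unfolding boundary_def
  proof (rule sum.cong)
    fix e assume "e \<in> {..<q} - A"
    then have e: "e \<notin> A'" "e \<noteq> j" using A' by auto
    have ins: "insert e A = insert j (insert e A')" "insert j (insert e A') - {j} = insert e A'"
      using A' e by auto
    have "face_sign e A * face_sign j (insert e A') = - (face_sign j A' * face_sign e A' :: 'k)"
      unfolding A'(1) using face_sign_insert[OF A'(3) A'(2), of e, where 'a = 'k]
        face_sign_insert[OF A'(3) e(1), of j, where 'a = 'k] e(2)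
      by (cases "e < j") (simp_all add: mult.commute)
    then have "face_sign e A * face_sign j (insert e A') * c (insert e A')
        = - (face_sign j A' * face_sign e A') * c (insert e A')"
      by (simp only:)
    then show "face_sign e A * cone j c (insert e A)
        = - face_sign j A' * (face_sign e A' * c (insert e A'))"
      by (simp add: cone_def ins face_sign_insert_self mult.assoc)
  qed simp
  also have "\<dots> = - face_sign j A' * ?s"
    by (simp add: sum_distrib_left)
  also have "\<dots> = c A"
    unfolding s by (simp add: face_sign_square flip: mult.assoc)
  finally show ?thesis .
qed

lemma mono_dvd_diff_add: "mono_dvd s t \<Longrightarrow> u + t - s = u + (t - s)"
  by (auto simp: mono_dvd_iff_add add.left_commute)

section \<open>The Taylor complex and its exactness\<close>

text \<open>
  An element of the Taylor complex assigns a polynomial to each face, a set of indices of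
  generators \<open>m e\<close>; the basis element of the face \<open>A\<close> has multidegree \<open>mono_lcm m A\<close>.
\<close>

definition taylor_diff ::
  "nat \<Rightarrow> (nat \<Rightarrow> 'v::finite \<Rightarrow>\<^sub>0 nat) \<Rightarrow> (nat set \<Rightarrow> ('v, 'k::field) mpoly) \<Rightarrow> nat set \<Rightarrow> ('v, 'k) mpoly"
  where "taylor_diff q m X A = (\<Sum>e\<in>{..<q} - A.
     Poly_Mapping.single (mono_lcm m (insert e A) - mono_lcm m A) (face_sign e A) * X (insert e A))"

text \<open>
  The coefficient in multidegree \<open>t\<close> at the face \<open>A\<close>: the monomial there has to be multiplied
  by the basis element of \<open>A\<close> to reach \<open>t\<close>. For fixed \<open>t\<close> this turns the Taylor differential
  into the boundary of the simplex.
\<close>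

definition multidegree_coeff ::
  "(nat \<Rightarrow> 'v::finite \<Rightarrow>\<^sub>0 nat) \<Rightarrow> ('v \<Rightarrow>\<^sub>0 nat) \<Rightarrow> (nat set \<Rightarrow> ('v, 'k::field) mpoly) \<Rightarrow> nat set \<Rightarrow> 'k"
  where "multidegree_coeff m t X A =
    (if mono_dvd (mono_lcm m A) t then Poly_Mapping.lookup (X A) (t - mono_lcm m A) else 0)"

lemma multidegree_coeff_add_lcm:
  "multidegree_coeff m (u + mono_lcm m A) X A = Poly_Mapping.lookup (X A) u"
  by (auto simp: multidegree_coeff_def mono_dvd_iff_add add.commute)

lemma multidegree_coeff_taylor_diff:
  assumes A: "A \<subseteq> {..<q}"
  shows "multidegree_coeff m t (taylor_diff q m X) A = boundary q (multidegree_coeff m t X) A"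
proof -
  have fin: "finite A" using A by (rule finite_subset) simp
  have dvd: "mono_dvd (mono_lcm m A) (mono_lcm m (insert e A))" for e
    using fin by (intro mono_lcm_mono) auto
  show ?thesis
  proof (cases "mono_dvd (mono_lcm m A) t")
    case True
    then obtain u where u: "t = mono_lcm m A + u" by (auto simp: mono_dvd_iff_add)
    have "Poly_Mapping.lookup (Poly_Mapping.single (mono_lcm m (insert e A) - mono_lcm m A) (face_sign e A)
             * X (insert e A)) u = face_sign e A * multidegree_coeff m t X (insert e A)" for e
    proof -
      obtain w where "mono_lcm m (insert e A) = mono_lcm m A + w"
        using dvd[of e] by (auto simp: mono_dvd_iff_add)
      moreover have "mono_dvd (mono_lcm m A + w) (mono_lcm m A + u) \<longleftrightarrow> mono_dvd w u"
        by (simp add: mono_dvd_def lookup_add)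
      ultimately show ?thesis
        by (simp add: lookup_single_mult multidegree_coeff_def u)
    qed
    then show ?thesis
      by (simp add: multidegree_coeff_def u boundary_def taylor_diff_def lookup_sum mono_dvd_iff_add)
  next
    case False
    have "\<not> mono_dvd (mono_lcm m (insert e A)) t" for e
      using False dvd[of e] unfolding mono_dvd_def by (meson order.trans)
    then show ?thesis
      using False by (simp add: multidegree_coeff_def boundary_def)
  qed
qed

lemma taylor_diff_taylor_diff:
  assumes A: "A \<subseteq> {..<q}"
  shows "taylor_diff q m (taylor_diff q m X) A = 0"
proof (rule poly_mapping_eqI)
  fix u
  let ?t = "u + mono_lcm m A"
  have "Poly_Mapping.lookup (taylor_diff q m (taylor_diff q m X) A) u
      = boundary q (multidegree_coeff m ?t (taylor_diff q m X)) A"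
    using multidegree_coeff_taylor_diff[OF A] by (metis multidegree_coeff_add_lcm)
  also have "\<dots> = boundary q (boundary q (multidegree_coeff m ?t X)) A"
    unfolding boundary_def[of q _ A] using A
    by (intro sum.cong) (auto simp: multidegree_coeff_taylor_diff)
  also have "\<dots> = 0" by (rule boundary_boundary[OF A])
  finally show "Poly_Mapping.lookup (taylor_diff q m (taylor_diff q m X) A) u
      = Poly_Mapping.lookup 0 u" by simp
qed

text \<open>
  In multidegree \<open>t\<close> the cycle is a simplicial one supported on faces whose lcm divides \<open>t\<close>.
  The cone from a vertex \<open>J t\<close> whose generator divides \<open>t\<close> keeps the lcm a divisor of \<open>t\<close>, so
  it does not leave this support. Such a vertex exists because the lcm of a nonempty face divides
  \<open>t\<close>. The cone point depends on \<open>t\<close> alone, so the contractions in the various multidegrees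
  fit together to polynomials \<open>Y B\<close>.
\<close>

lemma taylor_diff_exact:
  fixes X :: "nat set \<Rightarrow> ('v::finite, 'k::field) mpoly"
  assumes X: "\<And>A. A \<subseteq> {..<q} \<Longrightarrow> card A = s \<Longrightarrow> taylor_diff q m X A = 0"
  obtains Y where "\<And>A. A \<subseteq> {..<q} \<Longrightarrow> card A = Suc s \<Longrightarrow> taylor_diff q m Y A = X A"
proof -
  define J where "J t = (SOME j. j < q \<and> mono_dvd (m j) t)" for t
  define Y :: "nat set \<Rightarrow> ('v, 'k) mpoly" where "Y B = Poly_Mapping.Abs_poly_mapping
    (\<lambda>u. cone (J (u + mono_lcm m B)) (multidegree_coeff m (u + mono_lcm m B) X) B)" for B
  have lookup_Y: "Poly_Mapping.lookup (Y B) u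
      = cone (J (u + mono_lcm m B)) (multidegree_coeff m (u + mono_lcm m B) X) B"
    if B: "finite B" for B u
  proof -
    \<comment> \<open>Finite support: each nonzero coefficient comes from one of the finitely many facets of
      \<open>B\<close>, by a shift of exponents that is injective.\<close>
    let ?w = "\<lambda>j. mono_lcm m B - mono_lcm m (B - {j})"
    have "{u. cone (J (u + mono_lcm m B)) (multidegree_coeff m (u + mono_lcm m B) X) B \<noteq> 0}
        \<subseteq> (\<Union>j\<in>B. (\<lambda>u. u + ?w j) -` Poly_Mapping.keys (X (B - {j})))"
    proof
      fix u
      let ?t = "u + mono_lcm m B" and ?j = "J (u + mono_lcm m B)"
      assume "u \<in> {u. cone (J (u + mono_lcm m B)) (multidegree_coeff m (u + mono_lcm m B) X) B \<noteq> 0}"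
      then have j: "?j \<in> B" and nz: "multidegree_coeff m ?t X (B - {?j}) \<noteq> 0"
        by (auto simp: cone_def split: if_splits)
      have "mono_dvd (mono_lcm m (B - {?j})) (mono_lcm m B)"
        using B by (intro mono_lcm_mono) auto
      then have "?t - mono_lcm m (B - {?j}) = u + ?w ?j"
        by (rule mono_dvd_diff_add)
      then have "u + ?w ?j \<in> Poly_Mapping.keys (X (B - {?j}))"
        using nz by (auto simp: multidegree_coeff_def in_keys_iff split: if_splits)
      then show "u \<in> (\<Union>j\<in>B. (\<lambda>u. u + ?w j) -` Poly_Mapping.keys (X (B - {j})))"
        using j by blast
    qed
    moreover have "finite (\<Union>j\<in>B. (\<lambda>u. u + ?w j) -` Poly_Mapping.keys (X (B - {j})))"
      using B by (intro finite_UN_I finite_vimageI) (auto simp: inj_on_def)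
    ultimately show ?thesis
      unfolding Y_def by (subst lookup_Abs_poly_mapping) (auto intro: finite_subset)
  qed
  have coeff_Y: "multidegree_coeff m t Y B = cone (J t) (multidegree_coeff m t X) B"
    if B: "finite B" and dvd: "mono_dvd (m (J t)) t" for B t
  proof (cases "mono_dvd (mono_lcm m B) t")
    case True
    then show ?thesis
      using lookup_Y[OF B]
      by (auto simp: multidegree_coeff_def[of m t Y] mono_dvd_iff_add add.commute)
  next
    case False
    have "multidegree_coeff m t X (B - {J t}) = 0" if "J t \<in> B"
    proof (rule ccontr)
      assume "multidegree_coeff m t X (B - {J t}) \<noteq> 0"
      then have "mono_dvd (mono_lcm m (B - {J t})) t"
        by (auto simp: multidegree_coeff_def split: if_splits)
      then have "mono_dvd (mono_lcm m B) t"
        using B dvd by (auto simp: mono_lcm_dvd_iff)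
      with False show False ..
    qed
    with False show ?thesis
      by (simp add: cone_def multidegree_coeff_def[of m t Y])
  qed
  show ?thesis
  proof (rule that[of Y], rule poly_mapping_eqI)
    fix A u assume A: "A \<subseteq> {..<q}" "card A = Suc s"
    then have fin: "finite A" by (intro finite_subset[OF A(1)]) simp
    let ?t = "u + mono_lcm m A"
    obtain a where a: "a \<in> A" using A(2) by (metis card.empty ex_in_conv nat.distinct(1))
    have "mono_dvd (mono_lcm m A) ?t"
      by (auto simp: mono_dvd_iff_add add.commute)
    then have "\<exists>j. j < q \<and> mono_dvd (m j) ?t"
      using a A fin by (auto simp: mono_lcm_dvd_iff)
    then have J: "J ?t < q" "mono_dvd (m (J ?t)) ?t"
      unfolding J_def by (metis (mono_tags, lifting) someI_ex)+
    have "Poly_Mapping.lookup (taylor_diff q m Y A) u = boundary q (multidegree_coeff m ?t Y) A"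
      using multidegree_coeff_taylor_diff[OF A(1)] by (metis multidegree_coeff_add_lcm)
    also have "\<dots> = boundary q (cone (J ?t) (multidegree_coeff m ?t X)) A"
      unfolding boundary_def[of q _ A] using fin J
      by (intro sum.cong) (auto simp: coeff_Y)
    also have "\<dots> = multidegree_coeff m ?t X A"
    proof (rule boundary_cone[OF J(1) A(1)])
      assume "J ?t \<in> A"
      then have "A - {J ?t} \<subseteq> {..<q}" "card (A - {J ?t}) = s"
        using A fin by auto
      then show "boundary q (multidegree_coeff m ?t X) (A - {J ?t}) = 0"
        using X by (simp add: multidegree_coeff_taylor_diff[symmetric])
          (simp add: multidegree_coeff_def)
    qed
    finally show "Poly_Mapping.lookup (taylor_diff q m Y A) u = Poly_Mapping.lookup (X A) u"
      by (simp add: multidegree_coeff_add_lcm)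
  qed
qed

section \<open>The Taylor resolution as matrices\<close>

text \<open>
  A list, so that its positions can serve as row and column indices.
\<close>

definition faces :: "nat \<Rightarrow> nat \<Rightarrow> nat set list" where
  "faces q s = filter (\<lambda>A. card A = s) (map set (subseqs [0..<q]))"

lemma set_faces: "set (faces q s) = {A. A \<subseteq> {..<q} \<and> card A = s}"
  using subseqs_powset[of "[0..<q]"] by (auto simp: faces_def atLeast0LessThan)

lemma distinct_faces: "distinct (faces q s)"
  unfolding faces_def by (intro distinct_filter distinct_set_subseqs) simp

lemma facesD: "a < length (faces q s) \<Longrightarrow> faces q s ! a \<subseteq> {..<q} \<and> card (faces q s ! a) = s"
  using nth_mem[of a "faces q s"] by (simp add: set_faces)

lemma faces_0: "faces q 0 = [{}]"
proof -
  have set: "set (faces q 0) = {{}}"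
    by (auto simp: set_faces dest: finite_subset)
  then have "length (faces q 0) = Suc 0"
    using distinct_card[OF distinct_faces[of q 0]] by simp
  then obtain A where A: "faces q 0 = [A]"
    by (metis length_0_conv length_Suc_conv)
  then show ?thesis
    using set unfolding A by simp
qed

text \<open>
  For consecutive sizes, \<open>B - A\<close> is a singleton exactly when \<open>A \<subseteq> B\<close>. Homological degree
  \<open>i\<close> of the resolution of the ideal corresponds to the faces of size \<open>i + 1\<close>; the only face
  of size 0 indexes the single row of the augmentation.
\<close>

definition taylor_coeff ::
  "(nat \<Rightarrow> 'v::finite \<Rightarrow>\<^sub>0 nat) \<Rightarrow> nat set \<Rightarrow> nat set \<Rightarrow> ('v, 'k::field) mpoly" where
  "taylor_coeff m A B = (if A \<subseteq> B
     then Poly_Mapping.single (mono_lcm m B - mono_lcm m A) (face_sign (the_elem (B - A)) A) else 0)"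

definition taylor_mat ::
  "nat \<Rightarrow> (nat \<Rightarrow> 'v::finite \<Rightarrow>\<^sub>0 nat) \<Rightarrow> nat \<Rightarrow> ('v, 'k::field) mpoly mat" where
  "taylor_mat q m s = mat (length (faces q s)) (length (faces q (Suc s)))
     (\<lambda>(a, b). taylor_coeff m (faces q s ! a) (faces q (Suc s) ! b))"

definition taylor_shifts :: "nat \<Rightarrow> (nat \<Rightarrow> 'v::finite \<Rightarrow>\<^sub>0 nat) \<Rightarrow> nat \<Rightarrow> nat list" where
  "taylor_shifts q m i = map (\<lambda>A. mon_degree (mono_lcm m A)) (faces q (Suc i))"

definition face_vec :: "nat \<Rightarrow> nat \<Rightarrow> (nat set \<Rightarrow> 'a) \<Rightarrow> 'a vec" where
  "face_vec q s X = vec (length (faces q s)) (\<lambda>a. X (faces q s ! a))"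

lemma face_vec_surj:
  assumes "x \<in> carrier_vec (length (faces q s))"
  shows "\<exists>X. x = face_vec q s X"
proof -
  define X where "X A = x $ (THE a. a < length (faces q s) \<and> faces q s ! a = A)" for A
  have "x = face_vec q s X"
  proof (rule eq_vecI)
    fix a assume "a < dim_vec (face_vec q s X)"
    then have a: "a < length (faces q s)" by (simp add: face_vec_def)
    then have "(THE b. b < length (faces q s) \<and> faces q s ! b = faces q s ! a) = a"
      using distinct_faces[of q s] by (intro the_equality) (auto simp: nth_eq_iff_index_eq)
    then show "x $ a = face_vec q s X $ a"
      using a by (simp add: face_vec_def X_def)
  qed (use assms in \<open>simp add: face_vec_def\<close>)
  then show ?thesis by (intro exI[of _ X])
qed

lemma carrier_vec_faces: "carrier_vec (length (faces q s)) = range (face_vec q s)"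
proof (intro equalityI subsetI)
  fix x :: "'a vec"
  assume "x \<in> carrier_vec (length (faces q s))"
  then obtain X where "x = face_vec q s X" using face_vec_surj by blast
  then show "x \<in> range (face_vec q s)" by simp
qed (auto simp: face_vec_def)

lemma face_vec_eq_iff:
  "face_vec q s X = face_vec q s Y \<longleftrightarrow> (\<forall>A. A \<subseteq> {..<q} \<longrightarrow> card A = s \<longrightarrow> X A = Y A)"
proof
  assume eq: "face_vec q s X = face_vec q s Y"
  show "\<forall>A. A \<subseteq> {..<q} \<longrightarrow> card A = s \<longrightarrow> X A = Y A"
  proof (intro allI impI)
    fix A assume "A \<subseteq> {..<q}" "card A = s"
    then obtain a where "a < length (faces q s)" "faces q s ! a = A"
      using set_faces[of q s] by (metis (mono_tags, lifting) in_set_conv_nth mem_Collect_eq)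
    then show "X A = Y A"
      using arg_cong[OF eq, of "\<lambda>x. x $ a"] by (simp add: face_vec_def)
  qed
next
  assume "\<forall>A. A \<subseteq> {..<q} \<longrightarrow> card A = s \<longrightarrow> X A = Y A"
  then have "X (faces q s ! a) = Y (faces q s ! a)" if "a < length (faces q s)" for a
    using facesD[OF that] by blast
  then show "face_vec q s X = face_vec q s Y"
    by (intro eq_vecI) (simp_all add: face_vec_def)
qed

lemma taylor_mat_mult_face_vec:
  "taylor_mat q m s *\<^sub>v face_vec q (Suc s) X = face_vec q s (taylor_diff q m X)"
proof (rule eq_vecI)
  fix a assume "a < dim_vec (face_vec q s (taylor_diff q m X))"
  then have a: "a < length (faces q s)" by (simp add: face_vec_def)
  define A where "A = faces q s ! a"
  have A: "A \<subseteq> {..<q}" "card A = s" and fin: "finite A"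
    using facesD[OF a] by (auto simp: A_def intro: finite_subset)
  have "(taylor_mat q m s *\<^sub>v face_vec q (Suc s) X) $ a
      = (\<Sum>b<length (faces q (Suc s)). taylor_coeff m A (faces q (Suc s) ! b) * X (faces q (Suc s) ! b))"
    using a by (simp add: taylor_mat_def face_vec_def A_def scalar_prod_def atLeast0LessThan)
  also have "\<dots> = (\<Sum>B\<in>set (faces q (Suc s)). taylor_coeff m A B * X B)"
    by (rule sum.reindex_bij_betw[OF bij_betw_nth[OF distinct_faces refl refl],
          of "\<lambda>B. taylor_coeff m A B * X B"])
  also have "\<dots> = (\<Sum>B\<in>(\<lambda>e. insert e A) ` ({..<q} - A). taylor_coeff m A B * X B)"
  proof (rule sum.mono_neutral_right)
    show "(\<lambda>e. insert e A) ` ({..<q} - A) \<subseteq> set (faces q (Suc s))"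
      using A fin by (auto simp: set_faces)
    show "\<forall>B\<in>set (faces q (Suc s)) - (\<lambda>e. insert e A) ` ({..<q} - A). taylor_coeff m A B * X B = 0"
    proof
      fix B assume B: "B \<in> set (faces q (Suc s)) - (\<lambda>e. insert e A) ` ({..<q} - A)"
      have "\<not> A \<subseteq> B"
      proof
        assume AB: "A \<subseteq> B"
        have BU: "B \<subseteq> {..<q}" "card B = Suc s" using B by (auto simp: set_faces)
        then have "card (B - A) = 1"
          using AB A fin by (simp add: card_Diff_subset)
        then obtain e where "B - A = {e}" by (auto simp: card_1_singleton_iff)
        then have "B = insert e A" "e \<in> {..<q} - A" using AB BU by auto
        with B show False by auto
      qed
      then show "taylor_coeff m A B * X B = 0" by (simp add: taylor_coeff_def)
    qed
  qed simp
  also have "\<dots> = taylor_diff q m X A"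
    unfolding taylor_diff_def
  proof (rule sum.reindex_cong[of "\<lambda>e. insert e A"])
    show "inj_on (\<lambda>e. insert e A) ({..<q} - A)" by (auto simp: inj_on_def)
    fix e assume "e \<in> {..<q} - A"
    then have "insert e A - A = {e}" by auto
    then show "taylor_coeff m A (insert e A) * X (insert e A)
      = Poly_Mapping.single (mono_lcm m (insert e A) - mono_lcm m A) (face_sign e A) * X (insert e A)"
      by (simp add: taylor_coeff_def subset_insertI)
  qed simp
  also have "\<dots> = face_vec q s (taylor_diff q m X) $ a"
    using a by (simp add: face_vec_def A_def)
  finally show "(taylor_mat q m s *\<^sub>v face_vec q (Suc s) X) $ a = face_vec q s (taylor_diff q m X) $ a" .
qed (simp add: taylor_mat_def face_vec_def)

section \<open>Projective dimension of irredundant monomial ideals\<close>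

lemma ideal_gen_finite:
  fixes g :: "nat \<Rightarrow> 'a::comm_ring_1"
  shows "ideal_gen (g ` {..<q}) = {(\<Sum>e<q. g e * x e) | x. True}"
proof -
  interpret M: Modules.module "(*) :: 'a \<Rightarrow> _ \<Rightarrow> _" by (rule module_times)
  show ?thesis
  proof (intro equalityI subsetI)
    fix p assume "p \<in> ideal_gen (g ` {..<q})"
    then have "p \<in> M.span (g ` {..<q})" by (simp add: ideal_gen_def)
    then have "\<exists>x. p = (\<Sum>e<q. g e * x e)"
    proof (induction rule: M.span_induct_alt)
      case base
      show ?case by (rule exI[of _ "\<lambda>_. 0"]) simp
    next
      case (step c h y)
      then obtain x k where x: "y = (\<Sum>e<q. g e * x e)" and k: "k < q" "h = g k" by auto
      have "(\<Sum>e<q. g e * (x e + (if e = k then c else 0))) = c * h + y"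
        using k by (simp add: x distrib_left sum.distrib if_distrib[of "\<lambda>z. g _ * z"] mult.commute cong: if_cong)
      then show ?case by metis
    qed
    then show "p \<in> {(\<Sum>e<q. g e * x e) | x. True}" by blast
  next
    fix p assume "p \<in> {(\<Sum>e<q. g e * x e) | x. True}"
    then obtain x where "p = (\<Sum>e<q. x e * g e)" by (auto simp: mult.commute)
    then show "p \<in> ideal_gen (g ` {..<q})"
      unfolding ideal_gen_def
      by (simp only:) (rule M.span_sum, rule M.span_scale, rule M.span_base, rule imageI)
  qed
qed

lemma single_in_ideal_gen_var:
  fixes c :: "'k::field"
  assumes "Poly_Mapping.lookup s v > 0"
  shows "Poly_Mapping.single s c \<in> ideal_gen (range (var :: 'v::finite \<Rightarrow> ('v, 'k) mpoly))"
proof -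
  interpret M: Modules.module "(*) :: ('v, 'k) mpoly \<Rightarrow> _ \<Rightarrow> _" by (rule module_times)
  have "mono_dvd (Poly_Mapping.single v 1) s"
    using assms by (auto simp: mono_dvd_def lookup_single when_def)
  then obtain u where "s = Poly_Mapping.single v 1 + u"
    by (auto simp: mono_dvd_iff_add)
  then have "Poly_Mapping.single s c = Poly_Mapping.single u c * var v"
    by (simp add: var_def mult_single add.commute)
  then show ?thesis
    unfolding ideal_gen_def by (simp only:) (intro M.span_scale M.span_base rangeI)
qed

lemma taylor_coeff_homogeneous:
  assumes "t \<in> Poly_Mapping.keys (taylor_coeff m A B :: ('v::finite, 'k::field) mpoly)" "finite B"
  shows "mon_degree t + mon_degree (mono_lcm m A) = mon_degree (mono_lcm m B)"
proof -
  have t: "A \<subseteq> B" "t = mono_lcm m B - mono_lcm m A"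
    using assms(1) by (auto simp: taylor_coeff_def split: if_splits)
  obtain u where "mono_lcm m B = mono_lcm m A + u"
    using mono_lcm_mono[OF assms(2) t(1), of m] by (auto simp: mono_dvd_iff_add)
  then show ?thesis
    by (simp add: t(2) mon_degree_add)
qed

theorem graded_free_resolution_taylor:
  fixes m :: "nat \<Rightarrow> 'v::finite \<Rightarrow>\<^sub>0 nat"
  shows "graded_free_resolution
    (ideal_gen ((\<lambda>e. Poly_Mapping.single (m e) (1 :: 'k::field)) ` {..<q}))
    (taylor_shifts q m) (taylor_mat q m)"
proof -
  have len: "length (taylor_shifts q m i) = length (faces q (Suc i))" for i
    by (simp add: taylor_shifts_def)
  have fin: "finite (faces q s ! a)" if "a < length (faces q s)" for s a
    using facesD[OF that] by (auto intro: finite_subset)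
  have M0: "(taylor_mat q m 0 *\<^sub>v face_vec q (Suc 0) X) $ 0
      = (\<Sum>e<q. Poly_Mapping.single (m e) 1 * X {e})" for X :: "nat set \<Rightarrow> ('v, 'k) mpoly"
    unfolding taylor_mat_mult_face_vec
    by (simp add: face_vec_def faces_0 taylor_diff_def mono_lcm_empty mono_lcm_singleton face_sign_def)
  have im: "(\<lambda>x. (taylor_mat q m 0 *\<^sub>v x) $ 0) ` carrier_vec (length (faces q (Suc 0)))
      = ideal_gen ((\<lambda>e. Poly_Mapping.single (m e) (1 :: 'k)) ` {..<q})"
  proof -
    have "(\<Sum>e<q. Poly_Mapping.single (m e) (1 :: 'k) * x e)
        \<in> range (\<lambda>X. \<Sum>e<q. Poly_Mapping.single (m e) 1 * X {e})" for x
      by (rule range_eqI[of _ _ "\<lambda>A. x (the_elem A)"]) simp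
    then show ?thesis
      unfolding carrier_vec_faces ideal_gen_finite image_image M0
      by (intro equalityI subsetI) auto
  qed
  have exact: "(\<lambda>x. taylor_mat q m (Suc i) *\<^sub>v x) ` carrier_vec (length (faces q (Suc (Suc i))))
      = mat_kernel (taylor_mat q m i :: ('v, 'k) mpoly mat)" for i
  proof -
    have zero: "0\<^sub>v (length (faces q s)) = (face_vec q s (\<lambda>_. 0) :: ('v, 'k) mpoly vec)" for s
      by (auto simp: face_vec_def)
    have "(taylor_mat q m i :: ('v, 'k) mpoly mat)
        \<in> carrier_mat (length (faces q i)) (length (faces q (Suc i)))"
      by (simp add: taylor_mat_def)
    from mat_kernel[OF this] have ker: "mat_kernel (taylor_mat q m i :: ('v, 'k) mpoly mat)
      = {face_vec q (Suc i) X | X. face_vec q i (taylor_diff q m X) = face_vec q i (\<lambda>_. 0)}"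
      unfolding carrier_vec_faces zero taylor_mat_mult_face_vec[symmetric]
      by (simp only:) blast
    show ?thesis
      unfolding ker carrier_vec_faces image_image taylor_mat_mult_face_vec
    proof (intro equalityI subsetI)
      fix x :: "('v, 'k) mpoly vec"
      assume "x \<in> range (\<lambda>Y. face_vec q (Suc i) (taylor_diff q m Y))"
      then show "x \<in> {face_vec q (Suc i) X | X.
          face_vec q i (taylor_diff q m X) = face_vec q i (\<lambda>_. 0 :: ('v, 'k) mpoly)}"
        by (auto simp: face_vec_eq_iff taylor_diff_taylor_diff)
    next
      fix x assume "x \<in> {face_vec q (Suc i) X | X.
          face_vec q i (taylor_diff q m X) = face_vec q i (\<lambda>_. 0 :: ('v, 'k) mpoly)}"
      then obtain X :: "nat set \<Rightarrow> ('v, 'k) mpoly" where x: "x = face_vec q (Suc i) X"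
        and "\<And>A. A \<subseteq> {..<q} \<Longrightarrow> card A = i \<Longrightarrow> taylor_diff q m X A = 0"
        by (auto simp: face_vec_eq_iff)
      then obtain Y where "\<And>A. A \<subseteq> {..<q} \<Longrightarrow> card A = Suc i \<Longrightarrow> taylor_diff q m Y A = X A"
        using taylor_diff_exact[of q i m X] by blast
      then have "x = face_vec q (Suc i) (taylor_diff q m Y)"
        unfolding x by (simp add: face_vec_eq_iff)
      then show "x \<in> range (\<lambda>Y. face_vec q (Suc i) (taylor_diff q m Y))" by (rule range_eqI[of _ _ Y])
    qed
  qed
  have hom0: "mon_degree t = taylor_shifts q m 0 ! b"
    if "b < length (faces q (Suc 0))"
      "t \<in> Poly_Mapping.keys (taylor_mat q m 0 $$ (0, b) :: ('v, 'k) mpoly)" for b t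
    using that taylor_coeff_homogeneous[of t m "{}" "faces q (Suc 0) ! b"] fin[OF that(1)]
    by (simp add: taylor_mat_def taylor_shifts_def faces_0 mono_lcm_empty mon_degree_def)
  have hom: "mon_degree t + taylor_shifts q m i ! a = taylor_shifts q m (Suc i) ! b"
    if "a < length (faces q (Suc i))" "b < length (faces q (Suc (Suc i)))"
      "t \<in> Poly_Mapping.keys (taylor_mat q m (Suc i) $$ (a, b) :: ('v, 'k) mpoly)" for i a b t
    using that taylor_coeff_homogeneous[of t m "faces q (Suc i) ! a" "faces q (Suc (Suc i)) ! b"]
      fin[OF that(2)]
    by (simp add: taylor_mat_def taylor_shifts_def)
  show ?thesis
    unfolding graded_free_resolution_def len im exact
    using hom0 hom by (auto simp: taylor_mat_def faces_0)
qed

text \<open>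
  The entry between \<open>A\<close> and \<open>insert e A\<close> is a unit exactly when adding \<open>m e\<close> does not change
  the lcm, that is, when \<open>m e\<close> divides the lcm of the generators in \<open>A\<close>. It suffices to exclude
  this for the largest \<open>A\<close> that does not contain \<open>e\<close>.
\<close>

theorem minimal_graded_free_resolution_taylor:
  fixes m :: "nat \<Rightarrow> 'v::finite \<Rightarrow>\<^sub>0 nat"
  assumes "\<And>e. e < q \<Longrightarrow> \<not> mono_dvd (m e) (mono_lcm m ({..<q} - {e}))"
  shows "minimal_graded_free_resolution
    (ideal_gen ((\<lambda>e. Poly_Mapping.single (m e) (1 :: 'k::field)) ` {..<q}))
    (taylor_shifts q m) (taylor_mat q m)"
  unfolding minimal_graded_free_resolution_def
proof (intro conjI allI subsetI)
  fix i p assume "p \<in> elements_mat (taylor_mat q m (Suc i) :: ('v, 'k) mpoly mat)"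
  then obtain a b where ab: "a < length (faces q (Suc i))" "b < length (faces q (Suc (Suc i)))"
    and p: "p = taylor_coeff m (faces q (Suc i) ! a) (faces q (Suc (Suc i)) ! b)"
    by (auto simp: taylor_mat_def dest!: elements_matD)
  define A B where "A = faces q (Suc i) ! a" and "B = faces q (Suc (Suc i)) ! b"
  have A: "A \<subseteq> {..<q}" "card A = Suc i" and B: "B \<subseteq> {..<q}" "card B = Suc (Suc i)"
    using ab facesD by (auto simp: A_def B_def)
  have finB: "finite B" using B(1) by (rule finite_subset) simp
  interpret M: Modules.module "(*) :: ('v, 'k) mpoly \<Rightarrow> _ \<Rightarrow> _" by (rule module_times)
  show "p \<in> ideal_gen (range var)"
  proof (cases "A \<subseteq> B")
    case True
    then obtain e where e: "e \<in> B" "e \<notin> A"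
      using A(2) B(2) by (metis n_not_Suc_n subsetI subset_antisym)
    then have "\<not> mono_dvd (m e) (mono_lcm m ({..<q} - {e}))"
      using B assms by auto
    moreover have "mono_dvd (mono_lcm m A) (mono_lcm m ({..<q} - {e}))"
      using A e by (intro mono_lcm_mono) auto
    ultimately have "\<not> mono_dvd (m e) (mono_lcm m A)"
      unfolding mono_dvd_def by (meson order.trans)
    moreover have "mono_dvd (m e) (mono_lcm m B)"
      using mono_lcm_mono[OF finB, of "{e}" m] e by (simp add: mono_lcm_singleton)
    ultimately have "\<not> mono_dvd (mono_lcm m B) (mono_lcm m A)"
      unfolding mono_dvd_def by (meson order.trans)
    then obtain v where "Poly_Mapping.lookup (mono_lcm m B - mono_lcm m A) v > 0"
      by (auto simp: mono_dvd_def lookup_minus not_le)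
    then show ?thesis
      using True p unfolding A_def[symmetric] B_def[symmetric] taylor_coeff_def
      by (simp add: single_in_ideal_gen_var)
  next
    case False
    then show ?thesis
      using p unfolding A_def[symmetric] B_def[symmetric] taylor_coeff_def ideal_gen_def
      by (simp add: M.span_zero)
  qed
qed (rule graded_free_resolution_taylor)

lemma faces_eq_Nil_iff: "faces q s = [] \<longleftrightarrow> q < s"
proof -
  have "{..<s} \<in> set (faces q s)" if "s \<le> q"
    using that by (auto simp: set_faces)
  moreover have "s \<le> q" if "A \<in> set (faces q s)" for A
    using that card_mono[of "{..<q}" A] by (auto simp: set_faces)
  ultimately show ?thesis
    by (metis length_greater_0_conv length_pos_if_in_set linorder_not_le list.set_intros(1) neq_Nil_conv)
qed

corollary proj_dim_irredundant_monomial_ideal: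
  fixes m :: "nat \<Rightarrow> 'v::finite \<Rightarrow>\<^sub>0 nat"
  assumes "\<And>e. e < q \<Longrightarrow> \<not> mono_dvd (m e) (mono_lcm m ({..<q} - {e}))" and "0 < q"
  shows "proj_dim (ideal_gen ((\<lambda>e. Poly_Mapping.single (m e) (1 :: 'k::field)) ` {..<q})) = q - 1"
proof -
  let ?I = "ideal_gen ((\<lambda>e. Poly_Mapping.single (m e) (1 :: 'k)) ` {..<q})"
  have "graded_betti ?I i j = count_list (taylor_shifts q m i) j" for i j
    using minimal_graded_free_resolution_taylor[OF assms(1)] by (rule graded_betti_eq_count_list)
  then have "(\<exists>j. graded_betti ?I i j \<noteq> 0) \<longleftrightarrow> i \<le> q - 1" for i
  proof -
    have "(\<exists>j. graded_betti ?I i j \<noteq> 0) \<longleftrightarrow> taylor_shifts q m i \<noteq> []"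
      using \<open>\<And>i j. graded_betti ?I i j = count_list (taylor_shifts q m i) j\<close>
      by (simp add: count_list_0_iff) (metis length_greater_0_conv nth_mem list.set(1) empty_iff)
    also have "\<dots> \<longleftrightarrow> i \<le> q - 1"
      using assms(2) by (auto simp: taylor_shifts_def faces_eq_Nil_iff)
    finally show ?thesis .
  qed
  then have "{i. \<exists>j. graded_betti ?I i j \<noteq> 0} = {..q - 1}" by auto
  then have "proj_dim ?I = Max {..q - 1}"
    by (simp only: proj_dim_def)
  also have "\<dots> = q - 1"
    by (rule Max_eqI) auto
  finally show ?thesis .
qed

section \<open>Rooted forests and their edge ideals\<close>

text \<open>
  Two different parents \<open>u\<close> and \<open>u'\<close> of \<open>v\<close> are the ends of walks from the root that avoid \<open>v\<close>.
  Joining these walks yields a path from \<open>u\<close> to \<open>u'\<close> avoiding \<open>v\<close>, and \<open>v\<close> closes it to an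
  undirected cycle of length at least 3.
\<close>

lemma rooted_tree_unique_parent:
  assumes wf: "wf_digraph T" and T: "rooted_tree T"
    and e: "e \<in> arcs T" and e': "e' \<in> arcs T" and head: "head T e = head T e'"
  shows "tail T e = tail T e'"
proof (rule ccontr)
  define u u' v where "u = tail T e" and "u' = tail T e'" and "v = head T e"
  assume "tail T e \<noteq> tail T e'"
  then have neq: "u \<noteq> u'" by (simp add: u_def u'_def)
  interpret T: wf_digraph T by (rule wf)
  interpret S: pair_wf_digraph "mk_symmetric T" by (rule T.wellformed_mk_symmetric)
  \<comment> \<open>Undirected adjacency with \<open>v\<close> deleted; it is symmetric, so walks can be reversed.\<close>
  define R where "R = {(a, b) \<in> parcs (mk_symmetric T). a \<noteq> v \<and> b \<noteq> v}"
  have "sym R"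
    by (auto simp: R_def sym_def parcs_mk_symmetric)
  have walk_R: "(r, x) \<in> R\<^sup>*" if "S.awalk r p x" "v \<notin> set (S.awalk_verts r p)" for r p x
    using that
  proof (induction p arbitrary: r)
    case Nil
    then show ?case by (simp add: S.awalk_Nil_iff)
  next
    case (Cons a p)
    then have a: "a \<in> parcs (mk_symmetric T)" "fst a = r" and w: "S.awalk (snd a) p x"
      and v: "v \<notin> set (S.awalk_verts (snd a) p)" "v \<noteq> r"
      by (auto simp: S.awalk_Cons_iff)
    have "snd a \<noteq> v"
      using v S.hd_in_awalk_verts(1)[OF w] by auto
    then have "(r, snd a) \<in> R"
      using a v by (auto simp: R_def)
    then show ?case
      using Cons.IH[OF w v(1)] by (rule converse_rtrancl_into_rtrancl)
  qed
  obtain r where r: "\<forall>e\<in>arcs T. \<exists>p. S.apath r (p @ [(tail T e, head T e)]) (head T e)"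
    using T by (auto simp: rooted_tree_def)
  have from_root: "(r, x) \<in> R\<^sup>*" if "S.apath r (p @ [(x, v)]) v" for x p
  proof -
    have "S.awlast r p = x" "S.awalk r p x" "v \<notin> set (S.awalk_verts r p)"
      using that by (auto simp: S.apath_append_iff S.apath_Cons_iff S.awalkI_apath)
    then show ?thesis by (intro walk_R)
  qed
  have "(r, u) \<in> R\<^sup>*" "(r, u') \<in> R\<^sup>*"
    using r e e' head from_root unfolding u_def u'_def v_def by metis+
  then have "(u, u') \<in> R\<^sup>*"
    using \<open>sym R\<close> by (meson rtrancl_trans sym_rtrancl symD)
  moreover have "u' \<in> verts T" "u' \<noteq> v"
  proof -
    show "u' \<in> verts T" using e' by (simp add: u'_def)
    obtain p where "S.apath r (p @ [(u', v)]) v"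
      using r e' head by (auto simp: u'_def v_def)
    then show "u' \<noteq> v"
      using S.no_loops_in_apath[of r "p @ [(u', v)]" v "(u', v)"] by simp
  qed
  ultimately obtain q where "S.awalk u q u'" "set q \<subseteq> R"
  proof (induction arbitrary: thesis rule: converse_rtrancl_induct)
    case base
    show ?case
      by (rule base(1)[of "[]"]) (use base in \<open>auto simp: S.awalk_Nil_iff\<close>)
  next
    case (step y z)
    then obtain q where q: "S.awalk z q u'" "set q \<subseteq> R" by blast
    show ?case
      by (rule step.prems(1)[of "(y, z) # q"])
        (use q step.hyps(1) in \<open>auto simp: S.awalk_Cons_iff R_def\<close>)
  qed
  then obtain q where q: "S.apath u q u'" "set q \<subseteq> R"
    using S.apath_awalk_to_apath S.awalk_to_apath_subset by (metis subset_trans)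
  have "q \<noteq> []"
    using q(1) neq by (auto simp: S.apath_Nil_iff)
  have "v \<notin> set (S.awalk_verts u q)"
  proof -
    have "set (S.awalk_verts u q) \<subseteq> fst ` set q \<union> snd ` set q"
      using S.set_awalk_verts_not_Nil[OF S.awalkI_apath[OF q(1)] \<open>q \<noteq> []\<close>] by auto
    then show ?thesis using q(2) unfolding R_def by fastforce
  qed
  have arcs: "(v, u) \<in> parcs (mk_symmetric T)" "(u', v) \<in> parcs (mk_symmetric T)"
    unfolding parcs_mk_symmetric u_def u'_def v_def
    by (rule UN_I[OF e], simp) (rule UN_I[OF e'], simp add: head)
  let ?c = "(v, u) # q @ [(u', v)]"
  have closing: "S.awalk u (q @ [(u', v)]) v"
    using arcs S.awalkI_apath[OF q(1)] S.arc_implies_awalk[of "(u', v)"] by simp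
  then have "S.awalk v ?c v"
    using arcs by (simp add: S.awalk_Cons_iff del: S.awalk_append_iff)
  moreover have "distinct (tl (S.awalk_verts v ?c))"
    using q(1) \<open>v \<notin> _\<close> S.awalk_verts_append[OF closing] by (simp add: S.apath_def)
  ultimately have "S.cycle ?c"
    by (auto simp: S.cycle_def)
  moreover have "3 \<le> length ?c"
    using \<open>q \<noteq> []\<close> by (cases q) auto
  ultimately show False
    using T by (auto simp: rooted_tree_def underlying_tree_def)
qed

lemma rooted_forest_unique_parent:
  assumes D: "rooted_forest D" and uv: "(u, v) \<in> parcs D" and u'v: "(u', v) \<in> parcs D"
  shows "u = u'"
proof -
  obtain P where P: "partition_on (pverts D) P" and sub: "parcs D \<subseteq> (\<Union>B\<in>P. B \<times> B)"
    and tree: "\<And>B. B \<in> P \<Longrightarrow> rooted_tree (with_proj D \<restriction> B)"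
    using D by (auto simp: rooted_forest_def)
  obtain B B' where B: "B \<in> P" "u \<in> B" "v \<in> B" and B': "B' \<in> P" "u' \<in> B'" "v \<in> B'"
    using uv u'v sub by blast
  have "B = B'"
    using P B B' unfolding partition_on_def disjoint_def by (metis IntI empty_iff)
  let ?T = "with_proj D \<restriction> B"
  have "wf_digraph ?T"
    by unfold_locales auto
  moreover have "(u, v) \<in> arcs ?T" "(u', v) \<in> arcs ?T"
    using uv u'v B B' \<open>B = B'\<close> by auto
  ultimately have "tail ?T (u, v) = tail ?T (u', v)"
    by (intro rooted_tree_unique_parent[OF _ tree[OF B(1)]]) simp_all
  then show ?thesis by simp
qed

definition edge_mono :: "('v \<Rightarrow> nat) \<Rightarrow> 'v \<times> 'v \<Rightarrow> 'v \<Rightarrow>\<^sub>0 nat" where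
  "edge_mono w e = Poly_Mapping.single (fst e) 1 + Poly_Mapping.single (snd e) (w (snd e))"

lemma var_power:
  "var v ^ n = (Poly_Mapping.single (Poly_Mapping.single v n) 1 :: ('v, 'k::comm_ring_1) mpoly)"
  by (induction n) (simp_all add: var_def mult_single flip: single_add)

lemma edge_monomial:
  "var u * var v ^ w v = (Poly_Mapping.single (edge_mono w (u, v)) 1 :: ('v, 'k::comm_ring_1) mpoly)"
  by (simp add: var_power edge_mono_def) (simp add: var_def mult_single)

theorem theorem1p2:
  fixes D :: "'v::finite pair_pre_digraph" and w :: "'v \<Rightarrow> nat"
  assumes "pverts D = UNIV"
    and "weighted_oriented_graph D w"
    and "rooted_forest D"
    and "parcs D \<noteq> {}"
    and "\<forall>x\<in>pverts D. 2 \<le> w x"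
  shows "proj_dim (edge_ideal D w :: ('v, 'k::field) mpoly set) = card (parcs D) - 1"
proof -
  have w: "2 \<le> w v" for v using assms(1,5) by simp
  obtain es where es: "set es = parcs D" "distinct es"
    using finite_distinct_list[OF finite[of "parcs D"]] by blast
  define q where "q = length es"
  define m where "m i = edge_mono w (es ! i)" for i
  have q: "card (parcs D) = q"
    using distinct_card[OF es(2)] es(1) by (simp add: q_def)
  have "edge_ideal D w = (ideal_gen ((\<lambda>i. Poly_Mapping.single (m i) 1) ` {..<q}) :: ('v, 'k) mpoly set)"
  proof -
    have "{var u * var v ^ w v | u v. (u, v) \<in> parcs D}
        = ((\<lambda>e. Poly_Mapping.single (edge_mono w e) 1) ` set es :: ('v, 'k) mpoly set)"
      unfolding es(1) edge_monomial by force
    also have "\<dots> = (\<lambda>i. Poly_Mapping.single (m i) 1) ` {..<q}"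
      by (auto simp: m_def q_def set_conv_nth)
    finally show ?thesis
      by (simp add: edge_ideal_def)
  qed
  moreover have "proj_dim (ideal_gen ((\<lambda>i. Poly_Mapping.single (m i) (1 :: 'k)) ` {..<q})) = q - 1"
  proof (rule proj_dim_irredundant_monomial_ideal)
    show "0 < q" using es assms(4) by (auto simp: q_def)
    fix i assume i: "i < q"
    obtain u v where uv: "es ! i = (u, v)" by fastforce
    then have uvD: "(u, v) \<in> parcs D"
      using nth_mem[of i es] i es by (simp add: q_def)
    \<comment> \<open>The head \<open>v\<close> of the edge witnesses irredundancy: in every other generator it is not
      a head, so it occurs there at most once, as a tail.\<close>
    have "Poly_Mapping.lookup (m k) v \<le> 1" if "k < q" "k \<noteq> i" for k
    proof -
      obtain x y where xy: "es ! k = (x, y)" by fastforce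
      then have xyD: "(x, y) \<in> parcs D"
        using nth_mem[of k es] that es by (simp add: q_def)
      have "y \<noteq> v"
      proof
        assume y: "y = v"
        have "x = u"
          using rooted_forest_unique_parent[OF assms(3)] uvD xyD[unfolded y] by blast
        then have "es ! k = es ! i"
          using uv xy y by simp
        then show False
          using that i nth_eq_iff_index_eq[OF es(2), of k i] by (simp add: q_def)
      qed
      then show ?thesis
        by (simp add: m_def xy edge_mono_def lookup_add lookup_single when_def)
    qed
    then have "Poly_Mapping.lookup (mono_lcm m ({..<q} - {i})) v \<le> 1"
      by (auto simp: lookup_mono_lcm)
    moreover have "2 \<le> Poly_Mapping.lookup (m i) v"
      using w[of v] by (simp add: m_def uv edge_mono_def lookup_add)
    ultimately have "\<not> Poly_Mapping.lookup (m i) v \<le> Poly_Mapping.lookup (mono_lcm m ({..<q} - {i})) v"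
      by linarith
    then show "\<not> mono_dvd (m i) (mono_lcm m ({..<q} - {i}))"
      by (auto simp: mono_dvd_def)
  qed
  ultimately show ?thesis by (simp add: q)
qed

end
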